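(* Let $u\in\mathcal{A}$ be a strong local minimizer of $E$ in $\mathcal{A}$, i.e. there is $\gamma>0$ such that $E(v)\ge E(u)$ for all $v\in\mathcal{A}$ with $\|v-u\|_{\infty;\Omega}<\gamma$. Assume that $F(u,B(z,\delta),r')=0$, where $B(z,\delta)$ is compactly contained in $\Omega$ and $0<r'<\operatorname{dist}(B(z,\delta),\partial\Omega)$, and let $x_0\in B(z,\delta)$ be such that $t(x):=t(x,x_0,u)\ge0$ for a.e. $x\in B(x_0,r')$. Let $0<2r<r'$ and let $f:[0,\infty)\to[0,1]$ be a smooth function with $f(R)=1$ for $0\le R\le r$, $f(R)=0$ for $R\ge2r$, $|f'(R)|\le c/r$ for $r<R<2r$ (with $c$ a constant independent of $x_0$, $r$, $R$), and $f'(R)\le0$ for all $R>0$. Put $R=|x-x_0|$, $\eta(x)=f(|x-x_0|)$, $a=u(x_0)$ and $d_u(x)=\det\nabla u(x)$. Then $$\lambda\int_\Omega\Big(\eta^2|\nabla u|^2+\nabla u\cdot\big((u-a)\otimes\nabla(\eta^2)\big)\Big)dx\ \le\ \int_{\{x\in\Omega:\,d_u(x)<1\}}\eta^2|h'(d_u)|\,d_u\,dx+\int_{\{x\in\Omega:\,d_u(x)\ge1\}}\eta\,t\,h'(d_u)\,|f'(R)|\,dx .$$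
   Context: $\Omega\subset\mathbb{R}^2$ is a bounded domain with Lipschitz boundary. $u_0:\overline\Omega\to\mathbb{R}^2$ is a homeomorphism onto its image, and $$\mathcal{A}_1=\{u\in W^{1,2}(\Omega,\mathbb{R}^2):\ \det\nabla u>0\ \text{a.e. in }\Omega,\ u|_{\partial\Omega}=u_0|_{\partial\Omega}\}$$ (boundary values in the sense of trace) is assumed nonempty. Every $u\in\mathcal{A}_1$ has a continuous representative in $\Omega$, with which it is identified. $A\cdot B$ denotes the Euclidean inner product of matrices. Energy: fix $\lambda>0$ and let $E(u)=\int_\Omega \lambda|\nabla u|^2+h(\det\nabla u)\,dx$, where $h:\mathbb{R}\to[0,+\infty]$ is given by $h(s)=+\infty$ for $s\le 0$, $h(s)=|\ln s|$ for $s\in(0,c_1)$, $h(s)=\theta(s)$ for $s\in[c_1,c_2]$, $h(s)=ls+m$ for $s>c_2$. Here $l,m>0$ and $0<c_1<1<c_2<+\infty$ are constants, and $\theta>0$ is of class $C^2$ on $(c_1,c_2)$ with $\ddot\theta>0$, $C^1$ up to the endpoints, $\theta(c_1)=|\ln c_1|$, $\theta(c_2)=lc_2+m$, $\dot\theta(c_1)=-1/c_1$, $\dot\theta(c_2)=l$, $\dot\theta(1)=0$, $\theta(1)>0$. (Thus $h$ is $C^1$ and convex on $(0,\infty)$ with its minimum at $1$.) Set $\mathcal{A}=\{u\in\mathcal{A}_1: E(u)<+\infty\}$. Twist: for $x_0\in\Omega$ and a.e. $x\in\Omega$, $$t(x,x_0,u)=\operatorname{adj}\nabla u(x)\,(u(x)-u(x_0))\cdot\frac{x-x_0}{|x-x_0|},$$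 where $\operatorname{adj}$ is the adjugate matrix (transpose of the cofactor matrix). Functional $F$: let $g(s)=-s$ for $s\le0$ and $g(s)=0$ for $s\ge0$. For $\Omega'$ compactly contained in $\Omega$ and $r'\in(0,\operatorname{dist}(\Omega',\partial\Omega))$, $$F(u,\Omega',r')=\int_{\Omega'}\int_{B(x_0,r')}g(t(x,x_0,u))\,dx\,dx_0 .$$ *)

theory Defs
  imports "HOL-Analysis.Analysis" "HOL-Probability.Essential_Supremum"
begin

text \<open>
  Classes \<open>C\<^sup>k(S)\<close> and \<open>C\<^sup>\<infinity>(S)\<close>. Derivatives are taken within \<open>S\<close>, so that on a
  nondegenerate closed interval they are one-sided at the endpoints; the definition is only used
  for open \<open>S\<close> and for such intervals, where the derivative within \<open>S\<close> is unique. In finite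
  dimension, continuity of all iterated directional derivatives is continuity of all partial
  derivatives.
\<close>

primrec C_k_on :: "nat \<Rightarrow> 'a::euclidean_space set \<Rightarrow> ('a \<Rightarrow> 'b::real_normed_vector) \<Rightarrow> bool" where
  "C_k_on 0 S f \<longleftrightarrow> continuous_on S f"
| "C_k_on (Suc k) S f \<longleftrightarrow>
     f differentiable_on S \<and> (\<forall>v. C_k_on k S (\<lambda>x. frechet_derivative f (at x within S) v))"

definition smooth_on :: "'a::euclidean_space set \<Rightarrow> ('a \<Rightarrow> 'b::real_normed_vector) \<Rightarrow> bool" where
  "smooth_on S f \<longleftrightarrow> (\<forall>k. C_k_on k S f)"

definition gradient :: "(real^2 \<Rightarrow> real) \<Rightarrow> real^2 \<Rightarrow> real^2" where
  "gradient \<phi> x = (\<chi> j. frechet_derivative \<phi> (at x) (axis j 1))"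

definition tensor :: "real^2 \<Rightarrow> real^2 \<Rightarrow> real^2^2"  (infixr "\<otimes>\<^sub>v" 75) where
  "p \<otimes>\<^sub>v q = (\<chi> i j. p $ i * q $ j)"

definition cof :: "real^2^2 \<Rightarrow> real^2^2" where
  "cof A = vector [vector [A$2$2, - (A$2$1)], vector [- (A$1$2), A$1$1]]"

definition adj :: "real^2^2 \<Rightarrow> real^2^2" where
  "adj A = transpose (cof A)"

definition compactly_contained :: "'a::topological_space set \<Rightarrow> 'a set \<Rightarrow> bool"
    (infix "\<subset>\<subset>" 50) where
  "A \<subset>\<subset> B \<longleftrightarrow> compact (closure A) \<and> closure A \<subseteq> B"

definition bounded_domain :: "(real^2) set \<Rightarrow> bool" where
  "bounded_domain \<Omega> \<longleftrightarrow> open \<Omega> \<and> connected \<Omega> \<and> \<Omega> \<noteq> {} \<and> bounded \<Omega>"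

text \<open>
  Near each boundary point, in suitable Cartesian coordinates \<open>(e\<^sub>1 \<bullet> x, e\<^sub>2 \<bullet> x)\<close>, the set is
  the region strictly above the graph of a Lipschitz function.
\<close>

definition lipschitz_boundary :: "(real^2) set \<Rightarrow> bool" where
  "lipschitz_boundary \<Omega> \<longleftrightarrow>
     (\<forall>p\<in>frontier \<Omega>. \<exists>\<rho>>0. \<exists>e\<^sub>1 e\<^sub>2 \<psi> L.
        norm e\<^sub>1 = 1 \<and> norm e\<^sub>2 = 1 \<and> e\<^sub>1 \<bullet> e\<^sub>2 = 0 \<and> L-lipschitz_on UNIV (\<psi> :: real \<Rightarrow> real) \<and>
        \<Omega> \<inter> ball p \<rho> = {x \<in> ball p \<rho>. \<psi> (e\<^sub>1 \<bullet> x) < e\<^sub>2 \<bullet> x})"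


subsection \<open>The space \<open>W\<^sup>1\<^sup>,\<^sup>2(\<Omega>, \<real>\<^sup>2)\<close>\<close>

definition test_functions :: "(real^2) set \<Rightarrow> (real^2 \<Rightarrow> real) set" where
  "test_functions \<Omega> = {\<phi>. smooth_on UNIV \<phi> \<and> {x. \<phi> x \<noteq> 0} \<subset>\<subset> \<Omega>}"

definition locally_integrable ::
    "(real^2) set \<Rightarrow> (real^2 \<Rightarrow> 'b::{banach,second_countable_topology}) \<Rightarrow> bool" where
  "locally_integrable \<Omega> f \<longleftrightarrow> (\<forall>K. compact K \<and> K \<subseteq> \<Omega> \<longrightarrow> integrable (lebesgue_on K) f)"

text \<open>The convention is \<open>(\<nabla>u) $ i $ j = \<partial>\<^sub>j u\<^sub>i\<close>.\<close>

definition is_weak_gradient ::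
    "(real^2) set \<Rightarrow> (real^2 \<Rightarrow> real^2) \<Rightarrow> (real^2 \<Rightarrow> real^2^2) \<Rightarrow> bool" where
  "is_weak_gradient \<Omega> u G \<longleftrightarrow>
     locally_integrable \<Omega> u \<and> locally_integrable \<Omega> G \<and>
     (\<forall>\<phi>\<in>test_functions \<Omega>. \<forall>i j.
        (LINT x|lebesgue_on \<Omega>. u x $ i * gradient \<phi> x $ j) =
        - (LINT x|lebesgue_on \<Omega>. G x $ i $ j * \<phi> x))"

text \<open>
  A weak gradient is determined only up to null sets; \<open>wgrad\<close> fixes an arbitrary representative.
\<close>

definition wgrad :: "(real^2) set \<Rightarrow> (real^2 \<Rightarrow> real^2) \<Rightarrow> real^2 \<Rightarrow> real^2^2" where
  "wgrad \<Omega> u = (SOME G. is_weak_gradient \<Omega> u G)"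

definition L2_on :: "(real^2) set \<Rightarrow> (real^2 \<Rightarrow> 'b::euclidean_space) \<Rightarrow> bool" where
  "L2_on \<Omega> f \<longleftrightarrow> f \<in> borel_measurable (lebesgue_on \<Omega>) \<and>
     integrable (lebesgue_on \<Omega>) (\<lambda>x. (norm (f x))\<^sup>2)"

definition W12 :: "(real^2) set \<Rightarrow> (real^2 \<Rightarrow> real^2) set" where
  "W12 \<Omega> = {u. L2_on \<Omega> u \<and> (\<exists>G. is_weak_gradient \<Omega> u G \<and> L2_on \<Omega> G)}"

definition W12_norm :: "(real^2) set \<Rightarrow> (real^2 \<Rightarrow> real^2) \<Rightarrow> real" where
  "W12_norm \<Omega> u = sqrt (LINT x|lebesgue_on \<Omega>. (norm (u x))\<^sup>2 + (norm (wgrad \<Omega> u x))\<^sup>2)"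

definition Linf_norm :: "(real^2) set \<Rightarrow> (real^2 \<Rightarrow> real^2) \<Rightarrow> ereal" where
  "Linf_norm \<Omega> u = esssup (lebesgue_on \<Omega>) (\<lambda>x. ereal (norm (u x)))"


subsection \<open>Traces\<close>

definition H1_outer :: "(real^2) set \<Rightarrow> ennreal" where
  "H1_outer A = (SUP \<delta>\<in>{0<..}. INF C\<in>{C :: nat \<Rightarrow> (real^2) set.
       A \<subseteq> (\<Union>i. C i) \<and> (\<forall>i. bounded (C i) \<and> diameter (C i) \<le> \<delta>)}.
     (\<Sum>i. ennreal (diameter (C i))))"

text \<open>
  One-dimensional Hausdorff measure on the Borel sets; \<open>H1_outer\<close> is a metric outer measure, so
  it is countably additive there.
\<close>

definition H1 :: "(real^2) measure" where
  "H1 = measure_of UNIV (sets borel) H1_outer"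

text \<open>
  On a Lipschitz domain the trace operator \<open>T : W\<^sup>1\<^sup>,\<^sup>2(\<Omega>) \<rightarrow> L\<^sup>2(\<partial>\<Omega>)\<close> is the continuous extension
  of \<open>w \<mapsto> w|\<partial>\<Omega>\<close> from \<open>W\<^sup>1\<^sup>,\<^sup>2(\<Omega>) \<inter> C(closure \<Omega>)\<close>, which is dense; \<open>has_trace \<Omega> u g\<close> says that
  \<open>T u = g\<close> in \<open>L\<^sup>2(\<partial>\<Omega>)\<close>. The values of the function \<open>u\<close> itself outside \<open>\<Omega>\<close> play no role.
\<close>

definition has_trace ::
    "(real^2) set \<Rightarrow> (real^2 \<Rightarrow> real^2) \<Rightarrow> (real^2 \<Rightarrow> real^2) \<Rightarrow> bool" where
  "has_trace \<Omega> u g \<longleftrightarrow>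
     (\<exists>w :: nat \<Rightarrow> real^2 \<Rightarrow> real^2.
        (\<forall>n. w n \<in> W12 \<Omega> \<and> continuous_on (closure \<Omega>) (w n)) \<and>
        (\<lambda>n. W12_norm \<Omega> (\<lambda>x. w n x - u x)) \<longlonglongrightarrow> 0 \<and>
        (\<lambda>n. \<integral>\<^sup>+x\<in>frontier \<Omega>. ennreal ((norm (w n x - g x))\<^sup>2) \<partial>H1) \<longlonglongrightarrow> 0)"


subsection \<open>Energy and admissible maps\<close>

definition h_data :: "(real \<Rightarrow> real) \<Rightarrow> real \<Rightarrow> real \<Rightarrow> real \<Rightarrow> real \<Rightarrow> bool" where
  "h_data \<theta> c\<^sub>1 c\<^sub>2 l m \<longleftrightarrow>
     l > 0 \<and> m > 0 \<and> 0 < c\<^sub>1 \<and> c\<^sub>1 < 1 \<and> 1 < c\<^sub>2 \<and>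
     (\<forall>s\<in>{c\<^sub>1..c\<^sub>2}. \<theta> s > 0) \<and>
     C_k_on 2 {c\<^sub>1<..<c\<^sub>2} \<theta> \<and> (\<forall>s\<in>{c\<^sub>1<..<c\<^sub>2}. deriv (deriv \<theta>) s > 0) \<and>
     C_k_on 1 {c\<^sub>1..c\<^sub>2} \<theta> \<and>
     \<theta> c\<^sub>1 = \<bar>ln c\<^sub>1\<bar> \<and> \<theta> c\<^sub>2 = l * c\<^sub>2 + m \<and>
     (\<theta> has_real_derivative (- 1 / c\<^sub>1)) (at c\<^sub>1 within {c\<^sub>1..c\<^sub>2}) \<and>
     (\<theta> has_real_derivative l) (at c\<^sub>2 within {c\<^sub>1..c\<^sub>2}) \<and>
     (\<theta> has_real_derivative 0) (at 1) \<and> \<theta> 1 > 0"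

definition h_fun :: "(real \<Rightarrow> real) \<Rightarrow> real \<Rightarrow> real \<Rightarrow> real \<Rightarrow> real \<Rightarrow> real \<Rightarrow> ennreal" where
  "h_fun \<theta> c\<^sub>1 c\<^sub>2 l m s =
     (if s \<le> 0 then \<infinity>
      else if s < c\<^sub>1 then ennreal \<bar>ln s\<bar>
      else if s \<le> c\<^sub>2 then ennreal (\<theta> s)
      else ennreal (l * s + m))"

text \<open>
  The derivative of \<open>h\<close> on \<open>(0,\<infinity>)\<close>, where \<open>h\<close> is finite and \<open>C\<^sup>1\<close>; the values at \<open>s \<le> 0\<close> are
  meaningless.
\<close>

definition h_deriv :: "(real \<Rightarrow> ennreal) \<Rightarrow> real \<Rightarrow> real" where
  "h_deriv h s = deriv (\<lambda>s. enn2real (h s)) s"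

definition energy ::
    "real \<Rightarrow> (real \<Rightarrow> ennreal) \<Rightarrow> (real^2) set \<Rightarrow> (real^2 \<Rightarrow> real^2) \<Rightarrow> ennreal" where
  "energy lam h \<Omega> u =
     (\<integral>\<^sup>+x. ennreal (lam * (norm (wgrad \<Omega> u x))\<^sup>2) + h (det (wgrad \<Omega> u x)) \<partial>lebesgue_on \<Omega>)"

text \<open>
  Maps of this class are identified with their continuous representatives in \<open>\<Omega>\<close>, hence the
  continuity requirement.
\<close>

definition admissible1 ::
    "(real^2) set \<Rightarrow> (real^2 \<Rightarrow> real^2) \<Rightarrow> (real^2 \<Rightarrow> real^2) set" where
  "admissible1 \<Omega> u\<^sub>0 =
     {u \<in> W12 \<Omega>. continuous_on \<Omega> u \<and> (AE x in lebesgue_on \<Omega>. det (wgrad \<Omega> u x) > 0) \<and>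
                has_trace \<Omega> u u\<^sub>0}"

definition admissible ::
    "real \<Rightarrow> (real \<Rightarrow> ennreal) \<Rightarrow> (real^2) set \<Rightarrow> (real^2 \<Rightarrow> real^2) \<Rightarrow> (real^2 \<Rightarrow> real^2) set" where
  "admissible lam h \<Omega> u\<^sub>0 = {u \<in> admissible1 \<Omega> u\<^sub>0. energy lam h \<Omega> u < \<infinity>}"

definition strong_local_minimizer ::
    "real \<Rightarrow> (real \<Rightarrow> ennreal) \<Rightarrow> (real^2) set \<Rightarrow> (real^2 \<Rightarrow> real^2) \<Rightarrow> (real^2 \<Rightarrow> real^2) \<Rightarrow> bool" where
  "strong_local_minimizer lam h \<Omega> u\<^sub>0 u \<longleftrightarrow>
     u \<in> admissible lam h \<Omega> u\<^sub>0 \<and>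
     (\<exists>\<gamma>>0. \<forall>v\<in>admissible lam h \<Omega> u\<^sub>0.
        Linf_norm \<Omega> (\<lambda>x. v x - u x) < ereal \<gamma> \<longrightarrow> energy lam h \<Omega> v \<ge> energy lam h \<Omega> u)"


subsection \<open>Twist\<close>

definition twist ::
    "(real^2) set \<Rightarrow> real^2 \<Rightarrow> real^2 \<Rightarrow> (real^2 \<Rightarrow> real^2) \<Rightarrow> real" where
  "twist \<Omega> x x\<^sub>0 u = (adj (wgrad \<Omega> u x) *v (u x - u x\<^sub>0)) \<bullet> ((x - x\<^sub>0) /\<^sub>R norm (x - x\<^sub>0))"

definition g_fun :: "real \<Rightarrow> real" where
  "g_fun s = (if s \<le> 0 then - s else 0)"

definition F_fun ::
    "(real^2) set \<Rightarrow> (real^2 \<Rightarrow> real^2) \<Rightarrow> (real^2) set \<Rightarrow> real \<Rightarrow> ennreal" where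
  "F_fun \<Omega> u \<Omega>' r' =
     (\<integral>\<^sup>+x\<^sub>0. (\<integral>\<^sup>+x. ennreal (g_fun (twist \<Omega> x x\<^sub>0 u)) \<partial>lebesgue_on (ball x\<^sub>0 r')) \<partial>lebesgue_on \<Omega>')"

end

(*
  Compare u with v = u - \<epsilon> \<zeta> (u - a), where \<zeta> = \<eta>^2. Since (u - a) \<otimes> \<nabla>\<zeta> has rank one,
  det \<nabla>v = (1 - \<epsilon> \<zeta>)^2 d + 2 \<epsilon> (1 - \<epsilon> \<zeta>) \<eta> |f'| t, and t \<ge> 0 on the support of \<eta> makes v admissible.
  By convexity of h, h(det \<nabla>v) - h(d) \<le> h'(det \<nabla>v) (det \<nabla>v - d); keeping only the terms of the right
  sign bounds this by \<epsilon> times an expression dominated by an integrable function. Dividing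
  E(v) - E(u) \<ge> 0 by \<epsilon> and letting \<epsilon> tend to 0 gives twice the claimed inequality.
  As wgrad is an arbitrary representative, identifying wgrad v requires uniqueness of weak gradients;
  the test functions for that are built from the given cutoff f.
*)
theory Submission
  imports Defs
begin

text \<open>The difficulty is to dominate (E(v) - E(u)) / \<epsilon> from above uniformly in
  \<epsilon>, although h' is unbounded near 0. The two growth regimes of h pay for it. Linear growth
  gives h' \<le> l, so where h'(det \<nabla>v) \<ge> 0 the increment costs at most l times the twist
  term, which is integrable because it pairs two square integrable matrix fields. The logarithm
  gives -h'(s) s \<le> \<open>1 / c\<^sub>1\<close>, a bound on the product and not on h' itself. To
  use it where h'(det \<nabla>v) < 0, the factor d must be exchanged for det \<nabla>v; for
  \<epsilon> \<le> 1/2 the sign of the twist term allows this at the price of a factor 4. The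
  tangent to h is taken at det \<nabla>v and not at d, because that is the side on which convexity
  bounds the increment from above. The derivative then depends on \<epsilon>, and continuity of h'
  at d > 0 recovers the limit integrand. The sets d < 1 and d \<ge> 1 of the conclusion are where
  the monotone function h', which vanishes at 1, has a fixed sign.\<close>

section \<open>Calculus of k times continuously differentiable functions\<close>

lemma differentiable_on_open_has_derivative:
  assumes "open S" "f differentiable_on S" "x \<in> S"
  shows "(f has_derivative frechet_derivative f (at x)) (at x)"
  using assms by (metis at_within_open differentiable_on_def frechet_derivative_works)

text \<open>Openness makes the derivative at a point of \<open>S\<close> depend only on the values
  in \<open>S\<close>, so the induction can pass to the derivatives. The implication
  \<open>imp\<close> is proved for arbitrary \<open>p\<close> and \<open>q\<close>, so that it
  serves in both directions.\<close>

lemma C_k_on_cong: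
  assumes "open S" "\<And>x. x \<in> S \<Longrightarrow> f x = g x"
  shows "C_k_on k S f \<longleftrightarrow> C_k_on k S g"
  using assms
proof (induction k arbitrary: f g)
  case 0
  then show ?case by (simp cong: continuous_on_cong)
next
  case (Suc k)
  have imp: "C_k_on (Suc k) S q" if eq: "\<And>x. x \<in> S \<Longrightarrow> p x = q x" and p: "C_k_on (Suc k) S p"
    for p q :: "'a \<Rightarrow> 'b"
  proof -
    have fd: "frechet_derivative p (at x within S) = frechet_derivative q (at x within S)"
      if "x \<in> S" for x
    proof -
      have "(q has_derivative frechet_derivative p (at x within S)) (at x within S)"
        using p that eq has_derivative_transform[OF that, of q p]
        by (simp add: differentiable_on_def frechet_derivative_works)
      then show ?thesis
        using that Suc.prems(1) frechet_derivative_at at_within_open by metis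
    qed
    have "q differentiable_on S"
      using p eq differentiable_transform_within[of p _ S 1 q]
      by (auto simp: differentiable_on_def)
    moreover have "C_k_on k S (\<lambda>x. frechet_derivative q (at x within S) v)" for v
      using p Suc.IH[OF Suc.prems(1), of "\<lambda>x. frechet_derivative p (at x within S) v"
          "\<lambda>x. frechet_derivative q (at x within S) v"] fd by auto
    ultimately show ?thesis by simp
  qed
  show ?case
    using imp[of f g] imp[of g f] Suc.prems(2) by metis
qed

text \<open>This form takes an explicit candidate \<open>f'\<close> and hides both
  \<open>frechet_derivative\<close> and the filter \<open>at x within S\<close>; the closure
  properties below all go through it.\<close>

lemma C_k_on_SucI:
  assumes "open S" "\<And>x. x \<in> S \<Longrightarrow> (f has_derivative f' x) (at x)"
    and "\<And>v. C_k_on k S (\<lambda>x. f' x v)"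
  shows "C_k_on (Suc k) S f"
proof -
  have "frechet_derivative f (at x within S) = f' x" if "x \<in> S" for x
    using assms(1,2) that by (metis at_within_open frechet_derivative_at)
  then have "C_k_on k S (\<lambda>x. frechet_derivative f (at x within S) v)" for v
    by (intro C_k_on_cong[OF assms(1), THEN iffD1, OF _ assms(3)]) simp
  moreover have "f differentiable_on S"
    using assms(2) by (meson differentiable_at_withinI differentiable_on_def differentiable_def)
  ultimately show ?thesis by simp
qed

lemma C_k_on_SucD:
  assumes "open S" "C_k_on (Suc k) S f"
  shows "\<And>x. x \<in> S \<Longrightarrow> (f has_derivative frechet_derivative f (at x)) (at x)"
    and "C_k_on k S (\<lambda>x. frechet_derivative f (at x) v)"
proof -
  show "\<And>x. x \<in> S \<Longrightarrow> (f has_derivative frechet_derivative f (at x)) (at x)"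
    using assms by (auto intro: differentiable_on_open_has_derivative)
  have "C_k_on k S (\<lambda>x. frechet_derivative f (at x within S) v)"
    using assms(2) by simp
  moreover have "frechet_derivative f (at x within S) v = frechet_derivative f (at x) v"
    if "x \<in> S" for x
    using assms(1) that by (metis at_within_open)
  ultimately show "C_k_on k S (\<lambda>x. frechet_derivative f (at x) v)"
    by (rule C_k_on_cong[OF assms(1), THEN iffD1, rotated])
qed

lemma C_k_on_imp_continuous_on: "C_k_on k S f \<Longrightarrow> continuous_on S f"
  by (cases k) (auto intro: differentiable_imp_continuous_on)

text \<open>At a point of the open set \<open>T\<close> the filter \<open>at x within S\<close> is
  already \<open>at x\<close>, even if \<open>S\<close> is not open. This carries the smoothness of
  the given cutoff from \<open>{0..}\<close> to \<open>{0<..}\<close>.\<close>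

lemma C_k_on_open_subset:
  assumes "C_k_on k S f" "open T" "T \<subseteq> S"
  shows "C_k_on k T f"
  using assms
proof (induction k arbitrary: f)
  case 0
  then show ?case using continuous_on_subset by auto
next
  case (Suc k)
  have at: "at x within S = at x" if "x \<in> T" for x
    using that Suc.prems(2,3) by (meson at_within_interior interior_maximal subsetD)
  show ?case
  proof (rule C_k_on_SucI[OF Suc.prems(2)])
    show "(f has_derivative frechet_derivative f (at x within S)) (at x)" if "x \<in> T" for x
      using Suc.prems(1,3) at[OF that] that
      by (metis C_k_on.simps(2) differentiable_on_def frechet_derivative_works subsetD)
    show "C_k_on k T (\<lambda>x. frechet_derivative f (at x within S) v)" for v
      using Suc by auto
  qed
qed

lemma C_k_on_Suc_imp: "open S \<Longrightarrow> C_k_on (Suc k) S f \<Longrightarrow> C_k_on k S f"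
proof (induction k arbitrary: f)
  case 0
  then show ?case using C_k_on_imp_continuous_on[of "Suc 0" S f] by auto
next
  case (Suc k)
  then show ?case
    by (metis C_k_on.simps(2))
qed

text \<open>Gluing: it allows a radial function to be treated separately near its centre and away
  from it.\<close>

lemma C_k_on_Un:
  assumes "open S" "open T" "C_k_on k S f" "C_k_on k T f"
  shows "C_k_on k (S \<union> T) f"
  using assms
proof (induction k arbitrary: f)
  case 0
  then show ?case using continuous_on_open_Un by auto
next
  case (Suc k)
  show ?case
  proof (rule C_k_on_SucI)
    show "(f has_derivative frechet_derivative f (at x)) (at x)" if "x \<in> S \<union> T" for x
      using that C_k_on_SucD(1)[OF Suc.prems(1,3)] C_k_on_SucD(1)[OF Suc.prems(2,4)] by auto
    show "C_k_on k (S \<union> T) (\<lambda>x. frechet_derivative f (at x) v)" for v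
      using Suc.IH[OF Suc.prems(1,2)] C_k_on_SucD(2)[OF Suc.prems(1,3)]
        C_k_on_SucD(2)[OF Suc.prems(2,4)] by auto
  qed (use assms in auto)
qed

lemma C_k_on_const: "open S \<Longrightarrow> C_k_on k S (\<lambda>x. c)"
proof (induction k arbitrary: c)
  case (Suc k)
  show ?case
    by (rule C_k_on_SucI[where f' = "\<lambda>x v. 0"]) (use Suc in auto)
qed simp

lemma C_k_on_linear:
  assumes "open S" "bounded_linear f"
  shows "C_k_on k S f"
proof (cases k)
  case 0
  then show ?thesis
    using assms linear_continuous_on by auto
next
  case (Suc j)
  then show ?thesis
    using C_k_on_SucI[OF assms(1), of f "\<lambda>x. f" j] assms C_k_on_const
    by (auto simp: bounded_linear_imp_has_derivative)
qed

lemma C_k_on_add: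
  "open S \<Longrightarrow> C_k_on k S f \<Longrightarrow> C_k_on k S g \<Longrightarrow> C_k_on k S (\<lambda>x. f x + g x)"
proof (induction k arbitrary: f g)
  case 0
  then show ?case by (auto intro: continuous_on_add)
next
  case (Suc k)
  show ?case
  proof (rule C_k_on_SucI[OF Suc.prems(1)])
    show "((\<lambda>x. f x + g x) has_derivative
        (\<lambda>v. frechet_derivative f (at x) v + frechet_derivative g (at x) v)) (at x)" if "x \<in> S" for x
      using C_k_on_SucD(1)[OF Suc.prems(1,2) that] C_k_on_SucD(1)[OF Suc.prems(1,3) that]
      by (rule has_derivative_add)
  qed (intro Suc.IH Suc.prems C_k_on_SucD(2))
qed

lemma C_k_on_mult:
  fixes f g :: "'a::euclidean_space \<Rightarrow> real"
  shows "open S \<Longrightarrow> C_k_on k S f \<Longrightarrow> C_k_on k S g \<Longrightarrow> C_k_on k S (\<lambda>x. f x * g x)"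
proof (induction k arbitrary: f g)
  case 0
  then show ?case by (auto intro: continuous_on_mult)
next
  case (Suc k)
  show ?case
  proof (rule C_k_on_SucI[OF Suc.prems(1)])
    show "((\<lambda>x. f x * g x) has_derivative
        (\<lambda>v. f x * frechet_derivative g (at x) v + frechet_derivative f (at x) v * g x)) (at x)"
      if "x \<in> S" for x
      using C_k_on_SucD(1)[OF Suc.prems(1,2) that] C_k_on_SucD(1)[OF Suc.prems(1,3) that]
      by (rule has_derivative_mult)
  qed (intro C_k_on_add Suc.IH Suc.prems C_k_on_SucD(2) C_k_on_Suc_imp[OF _ Suc.prems(2)]
        C_k_on_Suc_imp[OF _ Suc.prems(3)])
qed

lemma C_k_on_comp:
  fixes g :: "real \<Rightarrow> real" and f :: "'a::euclidean_space \<Rightarrow> real"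
  shows "open S \<Longrightarrow> open T \<Longrightarrow> f ` S \<subseteq> T \<Longrightarrow> C_k_on k T g \<Longrightarrow> C_k_on k S f \<Longrightarrow>
    C_k_on k S (\<lambda>x. g (f x))"
proof (induction k arbitrary: g)
  case 0
  then show ?case by (auto intro: continuous_on_compose2)
next
  case (Suc k)
  let ?g' = "\<lambda>y. frechet_derivative g (at y) 1"
  show ?case
  proof (rule C_k_on_SucI[OF Suc.prems(1)])
    fix x assume x: "x \<in> S"
    have g: "(g has_derivative frechet_derivative g (at (f x))) (at (f x))"
      using C_k_on_SucD(1)[OF Suc.prems(2,4), of "f x"] x Suc.prems(3) by auto
    \<comment> \<open>A linear map on the reals is multiplication by its value at 1. The chain rule
      thus yields a product of scalar functions, one of which is again a composition with
      \<open>f\<close>; hence the induction varies \<open>g\<close> and keeps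
      \<open>f\<close>.\<close>
    have "frechet_derivative g (at (f x)) t = t * ?g' (f x)" for t
      using linear_scale[OF has_derivative_linear[OF g], of t 1] by simp
    then have D: "frechet_derivative g (at (f x)) = (\<lambda>t. t * ?g' (f x))"
      by blast
    show "((\<lambda>x. g (f x)) has_derivative
        (\<lambda>v. frechet_derivative f (at x) v * ?g' (f x))) (at x)"
      using has_derivative_compose[OF C_k_on_SucD(1)[OF Suc.prems(1,5) x] has_derivative_eq_rhs[OF g D]] .
  next
    fix v
    have "C_k_on k S (\<lambda>x. ?g' (f x))"
      using Suc.IH Suc.prems C_k_on_SucD(2)[OF Suc.prems(2,4)] C_k_on_Suc_imp[OF _ Suc.prems(5)]
      by blast
    then show "C_k_on k S (\<lambda>x. frechet_derivative f (at x) v * ?g' (f x))"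
      using C_k_on_mult C_k_on_SucD(2)[OF Suc.prems(1,5)] Suc.prems(1) by blast
  qed
qed

text \<open>Arbitrary \<open>c\<close> and \<open>p\<close> make the family closed under
  differentiation, which the induction needs; only \<open>p = 1/2\<close> is used.\<close>

lemma C_k_on_powr: "C_k_on k {0<..} (\<lambda>s::real. c * s powr p)"
proof (induction k arbitrary: c p)
  case 0
  then show ?case by (auto intro!: continuous_intros)
next
  case (Suc k)
  show ?case
  proof (rule C_k_on_SucI)
    show "((\<lambda>s. c * s powr p) has_derivative (\<lambda>v. (v * (c * p)) * x powr (p - 1))) (at x)"
      if "x \<in> {0<..}" for x
      using that by (auto intro!: derivative_eq_intros simp: field_simps powr_diff)
  qed (use Suc in auto)
qed

text \<open>The norm is the square root of a sum of squares of affine functions, and this sum is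
  positive away from \<open>a\<close>.\<close>

lemma C_k_on_norm_diff: "C_k_on k (- {a}) (\<lambda>x. norm (x - a))"
  for a :: "'a::euclidean_space"
proof -
  have lin: "C_k_on k (- {a}) (\<lambda>x. (x - a) \<bullet> b)" for b
    using C_k_on_add[OF _ C_k_on_linear[OF _ bounded_linear_inner_left[of b]]
        C_k_on_const[where c = "- (a \<bullet> b)"], of "- {a}" k]
    by (simp add: inner_diff_left open_Compl)
  have sum: "C_k_on k (- {a}) (\<lambda>x. \<Sum>b\<in>B. ((x - a) \<bullet> b) * ((x - a) \<bullet> b))" if "finite B" for B
    using that
  proof induction
    case empty
    then show ?case by (simp add: C_k_on_const open_Compl)
  next
    case (insert b B)
    then show ?case
      by (simp add: C_k_on_add[OF _ C_k_on_mult[OF _ lin lin]] open_Compl)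
  qed
  have "C_k_on k (- {a}) (\<lambda>x. 1 * ((x - a) \<bullet> (x - a)) powr (1/2))"
  proof (rule C_k_on_comp[where T = "{0<..}" and g = "\<lambda>s. 1 * s powr (1/2)"])
    show "C_k_on k (- {a}) (\<lambda>x. (x - a) \<bullet> (x - a))"
      using sum[of Basis] by (simp add: euclidean_inner[symmetric])
    show "C_k_on k {0<..} (\<lambda>s::real. 1 * s powr (1/2))"
      by (rule C_k_on_powr)
  qed auto
  then show ?thesis
    by (simp add: powr_half_sqrt norm_eq_sqrt_inner)
qed

lemma smooth_on_open_subset: "smooth_on S f \<Longrightarrow> open T \<Longrightarrow> T \<subseteq> S \<Longrightarrow> smooth_on T f"
  unfolding smooth_on_def using C_k_on_open_subset by blast

lemma smooth_on_mult:
  fixes f g :: "'a::euclidean_space \<Rightarrow> real"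
  shows "open S \<Longrightarrow> smooth_on S f \<Longrightarrow> smooth_on S g \<Longrightarrow> smooth_on S (\<lambda>x. f x * g x)"
  unfolding smooth_on_def using C_k_on_mult by blast

lemma smooth_on_prod:
  fixes f :: "'i \<Rightarrow> 'a::euclidean_space \<Rightarrow> real"
  assumes "open S" "\<And>i. i \<in> I \<Longrightarrow> smooth_on S (f i)"
  shows "smooth_on S (\<lambda>x. \<Prod>i\<in>I. f i x)"
  using assms(2)
  by (induction I rule: infinite_finite_induct)
     (auto simp: smooth_on_def assms(1) C_k_on_const C_k_on_mult)

lemma smooth_on_affine_comp:
  fixes g :: "real \<Rightarrow> real" and f :: "'a::euclidean_space \<Rightarrow> real"
  assumes "smooth_on UNIV g" "bounded_linear f"
  shows "smooth_on UNIV (\<lambda>x. g (f x + c))"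
  unfolding smooth_on_def
proof
  fix k
  show "C_k_on k UNIV (\<lambda>x. g (f x + c))"
  proof (rule C_k_on_comp[where T = UNIV and g = g and f = "\<lambda>x. f x + c"])
    show "C_k_on k UNIV (\<lambda>x. f x + c)"
      by (intro C_k_on_add C_k_on_linear C_k_on_const assms(2) open_UNIV)
    show "C_k_on k UNIV g"
      using assms(1) by (simp add: smooth_on_def)
  qed auto
qed

text \<open>The norm is singular only at the centre, and there the profile is constant, so the two
  open sets \<open>- {a}\<close> and \<open>ball a \<epsilon>\<close> suffice.\<close>

lemma smooth_on_radial:
  fixes g :: "real \<Rightarrow> real" and a :: "'a::euclidean_space"
  assumes "smooth_on {0<..} g" "\<epsilon> > 0" "\<And>s. 0 \<le> s \<Longrightarrow> s < \<epsilon> \<Longrightarrow> g s = c"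
  shows "smooth_on UNIV (\<lambda>x. g (norm (x - a)))"
  unfolding smooth_on_def
proof
  fix k
  have "C_k_on k (- {a}) (\<lambda>x. g (norm (x - a)))"
  proof (rule C_k_on_comp[where T = "{0<..}" and g = g and f = "\<lambda>x. norm (x - a)"])
    show "C_k_on k {0<..} g"
      using assms(1) by (simp add: smooth_on_def)
  qed (auto simp: C_k_on_norm_diff open_Compl)
  moreover have "C_k_on k (ball a \<epsilon>) (\<lambda>x. g (norm (x - a)))"
    by (rule C_k_on_cong[THEN iffD1, OF _ _ C_k_on_const[of _ _ c]])
       (auto simp: dist_norm norm_minus_commute assms(3))
  moreover have "- {a} \<union> ball a \<epsilon> = UNIV"
    using assms(2) by auto
  ultimately show "C_k_on k UNIV (\<lambda>x. g (norm (x - a)))"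
    using C_k_on_Un[of "- {a}" "ball a \<epsilon>" k "\<lambda>x. g (norm (x - a))"] open_Compl[OF closed_singleton[of a]]
    by (metis open_ball)
qed

section \<open>The fundamental lemma of the calculus of variations\<close>

text \<open>Open boxes form an intersection-stable generator of the Borel sets, so a Dynkin argument
  extends the vanishing of the integral to every Borel set.\<close>

lemma AE_zero_of_box_integrals_zero:
  fixes g :: "'a::euclidean_space \<Rightarrow> real"
  assumes g: "integrable lebesgue g"
    and box: "\<And>a b. (LINT x|lebesgue. indicator (box a b) x * g x) = 0"
  shows "AE x in lebesgue. g x = 0"
proof -
  \<comment> \<open>The boxes generate the Borel sets only, so the argument runs with a Borel
    version of \<open>g\<close>.\<close>
  obtain g' where g'[measurable]: "g' \<in> borel_measurable lborel" and AE: "AE x in lborel. g x = g' x"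
    using completion_ex_borel_measurable_real[OF borel_measurable_integrable[OF g]] by auto
  have AE': "AE x in lebesgue. g x = g' x"
    using AE by (rule AE_completion)
  have "integrable lebesgue g'"
    by (rule integrable_cong_AE_imp[OF g measurable_completion[OF g']]) (use AE' in eventually_elim, simp)
  then have int: "integrable lborel g'"
    by (simp add: integrable_completion)
  have box': "(LINT x:box a b|lborel. g' x) = 0" for a b
  proof -
    have "(LINT x|lebesgue. indicator (box a b) x * g' x) = (LINT x|lebesgue. indicator (box a b) x * g x)"
      using AE' g' g by (intro integral_cong_AE) (auto intro!: borel_measurable_times borel_measurable_indicator measurable_completion[of g' lborel]
          borel_measurable_integrable[OF g])
    then show ?thesis
      using box by (simp add: set_lebesgue_integral_def integral_completion)
  qed
  have si: "set_integrable lborel A g'" if "A \<in> sets borel" for A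
    using int that integrable_mult_indicator[of A lborel g'] by (simp add: set_integrable_def)
  have "(LINT x:A|lborel. g' x) = 0" if "A \<in> sigma_sets UNIV (range (\<lambda>(a, b). box a b))" for A
  proof -
    have "Int_stable (range (\<lambda>(a, b). box a b :: 'a set))"
      by (auto simp: Int_stable_def box_Int_box image_iff)
    moreover have "range (\<lambda>(a, b). box a b) \<subseteq> Pow UNIV"
      by auto
    ultimately show ?thesis
      using that
    proof (induction rule: sigma_sets_induct_disjoint)
      case (basic A)
      then show ?case using box' by auto
    next
      case empty
      show ?case by (simp add: set_lebesgue_integral_def)
    next
      case (compl A)
      have A: "A \<in> sets borel"
        using compl(1) by (simp add: borel_eq_box)
      \<comment> \<open>Complements require the integral over the whole space to vanish; it is the
        limit over the boxes with corners -n and n.\<close>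
      have "(\<lambda>n. LINT x:box (- real n *\<^sub>R One) (real n *\<^sub>R One)|lborel. g' x) \<longlonglongrightarrow>
          (LINT x:(\<Union>n. box (- real n *\<^sub>R One) (real n *\<^sub>R One))|lborel. g' x)"
      proof (rule set_integral_cont_up)
        show "set_integrable lborel (\<Union>n. box (- real n *\<^sub>R One) (real n *\<^sub>R One)) g'"
          by (rule si) auto
        show "incseq (\<lambda>n. box (- real n *\<^sub>R One) (real n *\<^sub>R One) :: 'a set)"
          unfolding incseq_def
        proof (intro allI impI subsetI)
          fix m n :: nat and x :: 'a
          assume "m \<le> n" "x \<in> box (- real m *\<^sub>R One) (real m *\<^sub>R One)"
          then have "- real n < x \<bullet> i \<and> x \<bullet> i < real n" if "i \<in> Basis" for i
            using that by (force simp: mem_box)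
          then show "x \<in> box (- real n *\<^sub>R One) (real n *\<^sub>R One)"
            by (simp add: mem_box)
        qed
      qed auto
      then have "(LINT x:UNIV|lborel. g' x) = 0"
        using box' by (simp add: UN_box_eq_UNIV LIMSEQ_const_iff)
      moreover have "(LINT x:UNIV|lborel. g' x) = (LINT x:A|lborel. g' x) + (LINT x:UNIV - A|lborel. g' x)"
        using A set_integral_Un[of A "UNIV - A" lborel g'] si by (simp add: Un_absorb1)
      ultimately show ?case using compl.IH by simp
    next
      case (union A)
      have "A i \<in> sets borel" for i
        using union(2) by (auto simp: borel_eq_box)
      then have "(LINT x:(\<Union>i. A i)|lborel. g' x) = (\<Sum>i. (LINT x:(A i)|lborel. g' x))"
        using union(1) by (intro lebesgue_integral_countable_add si) (auto simp: disjoint_family_on_def)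
      then show ?case using union.IH by simp
    qed
  qed
  then have "AE x in lborel. g' x = 0"
    by (intro sigma_finite_measure.density_zero[OF sigma_finite_lborel int]) (auto simp: borel_eq_box)
  then have "AE x in lebesgue. g' x = 0"
    by (rule AE_completion)
  with AE' show ?thesis
    by eventually_elim simp
qed

text \<open>The one-dimensional profile from which all bump functions are built. It stays a
  hypothesis of the lemmas below until \<open>smooth_step_of_cutoff\<close> extracts one from the
  given cutoff; the thresholds 1 and 2 are the radii r and 2r rescaled.\<close>

definition smooth_step :: "(real \<Rightarrow> real) \<Rightarrow> bool" where
  "smooth_step G \<longleftrightarrow> smooth_on UNIV G \<and> range G \<subseteq> {0..1} \<and> (\<forall>y\<le>1. G y = 0) \<and> (\<forall>y\<ge>2. G y = 1)"

lemma smooth_step_box_approximation: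
  fixes a b :: "real^2" and G :: "real \<Rightarrow> real"
  assumes G: "smooth_step G" and ab: "cbox a b \<subseteq> \<Omega>"
  obtains \<phi> :: "nat \<Rightarrow> real^2 \<Rightarrow> real" where "\<And>n. \<phi> n \<in> test_functions \<Omega>"
    and "\<And>n x. \<phi> n x \<in> {0..1}"
    and "\<And>n x. x \<notin> box a b \<Longrightarrow> \<phi> n x = 0"
    and "\<And>x. (\<lambda>n. \<phi> n x) \<longlonglongrightarrow> indicator (box a b) x"
proof
  \<comment> \<open>One factor per face of the box: it vanishes up to distance 1/(n+1) from the face
    and equals 1 from distance 2/(n+1) on. Hence each \<open>\<phi> n\<close> is supported in the
    closed box, while every interior point eventually gets the value 1.\<close>
  define \<phi> where "\<phi> = (\<lambda>n (x::real^2). \<Prod>i\<in>UNIV. G (real (Suc n) * (x$i - a$i)) * G (real (Suc n) * (b$i - x$i)))"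
  have G01: "G y \<ge> 0" "G y \<le> 1" for y
    using G by (auto simp: smooth_step_def subset_eq)
  have z: "\<phi> n x = 0" if x: "x \<notin> box a b" for n x
  proof -
    obtain i where "x$i \<le> a$i \<or> b$i \<le> x$i"
      using x by (metis mem_box_cart(1) not_less)
    then have "real (Suc n) * (x$i - a$i) \<le> 0 \<or> real (Suc n) * (b$i - x$i) \<le> 0"
      by (auto simp: mult_le_0_iff)
    then have "G (real (Suc n) * (x$i - a$i)) = 0 \<or> G (real (Suc n) * (b$i - x$i)) = 0"
      using G unfolding smooth_step_def by (meson order_trans zero_le_one)
    then have "G (real (Suc n) * (x$i - a$i)) * G (real (Suc n) * (b$i - x$i)) = 0"
      by auto
    then show ?thesis
      unfolding \<phi>_def by (metis (mono_tags, lifting) finite iso_tuple_UNIV_I prod_zero)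
  qed
  show "x \<notin> box a b \<Longrightarrow> \<phi> n x = 0" for n x
    by (rule z)
  show "\<phi> n x \<in> {0..1}" for n x
    unfolding \<phi>_def by (auto intro!: prod_nonneg prod_le_1 mult_nonneg_nonneg mult_le_one G01)
  have "smooth_on UNIV (\<phi> n)" for n
  proof -
    have lin: "bounded_linear (\<lambda>x::real^2. c * x$i)" for c i
      by (rule bounded_linear_const_mult[OF bounded_linear_vec_nth])
    have sm: "smooth_on UNIV (\<lambda>x::real^2. G (c * x$i + d))" for c i d
      by (rule smooth_on_affine_comp[OF _ lin]) (use G in \<open>simp add: smooth_step_def\<close>)
    have "smooth_on UNIV (\<lambda>x::real^2. G (real (Suc n) * (x$i - a$i)))" for i
      using sm[of "real (Suc n)" i "- real (Suc n) * a$i"] by (simp add: algebra_simps)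
    moreover have "smooth_on UNIV (\<lambda>x::real^2. G (real (Suc n) * (b$i - x$i)))" for i
      using sm[of "- real (Suc n)" i "real (Suc n) * b$i"] by (simp add: algebra_simps)
    ultimately show ?thesis
      unfolding \<phi>_def by (intro smooth_on_prod smooth_on_mult) auto
  qed
  moreover have "closure {x. \<phi> n x \<noteq> 0} \<subseteq> cbox a b" for n
    by (rule closure_minimal) (use z box_subset_cbox in blast)+
  ultimately show "\<phi> n \<in> test_functions \<Omega>" for n
    using ab compact_Int_closed[OF compact_cbox[of a b] closed_closure[of "{x. \<phi> n x \<noteq> 0}"]]
    unfolding test_functions_def compactly_contained_def by (auto simp: Int_absorb1)
  show "(\<lambda>n. \<phi> n x) \<longlonglongrightarrow> indicator (box a b) x" for x
  proof (cases "x \<in> box a b")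
    case False
    then show ?thesis using z by simp
  next
    case True
    have lim1: "(\<lambda>n. G (real (Suc n) * c)) \<longlonglongrightarrow> 1" if "c > 0" for c
    proof (rule tendsto_eventually)
      obtain N :: nat where "2 / c < real N"
        using reals_Archimedean2 by blast
      then have "G (real (Suc n) * c) = 1" if "n \<ge> N" for n
      proof -
        have "2 / c \<le> real (Suc n)" using \<open>2 / c < real N\<close> that by linarith
        then have "2 \<le> real (Suc n) * c" using \<open>c > 0\<close> by (simp add: pos_divide_le_eq)
        then show ?thesis using G by (simp add: smooth_step_def)
      qed
      then show "\<forall>\<^sub>F n in sequentially. G (real (Suc n) * c) = 1"
        by (auto simp: eventually_sequentially)
    qed
    have "(\<lambda>n. \<phi> n x) \<longlonglongrightarrow> (\<Prod>i\<in>(UNIV::2 set). 1 * 1)"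
      unfolding \<phi>_def using True
      by (intro tendsto_prod tendsto_mult lim1) (auto simp: mem_box_cart)
    then show ?thesis using True by simp
  qed
qed

lemma continuous_on_UNIV_lebesgue_measurable:
  fixes f :: "'a::euclidean_space \<Rightarrow> 'b::topological_space"
  shows "continuous_on UNIV f \<Longrightarrow> f \<in> borel_measurable lebesgue"
  by (rule measurable_completion) (simp add: borel_measurable_continuous_onI)

lemma smooth_on_imp_continuous_on: "smooth_on S f \<Longrightarrow> continuous_on S f"
  unfolding smooth_on_def by (metis C_k_on.simps(1))

lemma test_functions_continuous: "\<phi> \<in> test_functions \<Omega> \<Longrightarrow> continuous_on UNIV \<phi>"
  by (simp add: test_functions_def smooth_on_imp_continuous_on)

lemma locally_integrable_imp_integrable_scaled:
  fixes f :: "real^2 \<Rightarrow> 'b::{banach,second_countable_topology}"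
  assumes "locally_integrable \<Omega> f" "compact K" "K \<subseteq> \<Omega>" "\<Omega> \<in> sets lebesgue"
    and "\<phi> \<in> borel_measurable lebesgue" "\<And>x. x \<in> \<Omega> \<Longrightarrow> \<bar>\<phi> x\<bar> \<le> B"
    and "\<And>x. x \<in> \<Omega> \<Longrightarrow> x \<notin> K \<Longrightarrow> \<phi> x = 0"
  shows "integrable (lebesgue_on \<Omega>) (\<lambda>x. \<phi> x *\<^sub>R f x)"
proof -
  have K: "K \<in> sets lebesgue"
    using assms(2) by (simp add: lmeasurable_compact fmeasurableD)
  have fK: "integrable lebesgue (\<lambda>x. indicator K x *\<^sub>R f x)"
    using assms(1)[unfolded locally_integrable_def, rule_format, of K] assms(2,3) K
    by (simp add: integrable_restrict_space)
  \<comment> \<open>Local integrability says nothing about \<open>f\<close> beyond compact sets, so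
    the integrand is rewritten as a bounded measurable factor times the restriction of
    \<open>f\<close> to \<open>K\<close>.\<close>
  have eq: "indicator \<Omega> x *\<^sub>R \<phi> x *\<^sub>R f x = (indicator \<Omega> x * \<phi> x) *\<^sub>R (indicator K x *\<^sub>R f x)" for x
    using assms(7)[of x] by (auto simp: indicator_def)
  have "integrable lebesgue (\<lambda>x. indicator \<Omega> x *\<^sub>R \<phi> x *\<^sub>R f x)"
  proof (rule Bochner_Integration.integrable_bound)
    show "integrable lebesgue (\<lambda>x. \<bar>B\<bar> *\<^sub>R norm (indicator K x *\<^sub>R f x))"
      using fK by (intro integrable_scaleR_right integrable_norm)
    show "(\<lambda>x. indicator \<Omega> x *\<^sub>R \<phi> x *\<^sub>R f x) \<in> borel_measurable lebesgue"
      unfolding eq using assms(4,5)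
      by (intro borel_measurable_scaleR[OF _ borel_measurable_integrable[OF fK]] borel_measurable_times
          borel_measurable_indicator) auto
    show "AE x in lebesgue. norm (indicator \<Omega> x *\<^sub>R \<phi> x *\<^sub>R f x) \<le> norm (\<bar>B\<bar> *\<^sub>R norm (indicator K x *\<^sub>R f x))"
    proof (rule AE_I2)
      fix x
      have "\<bar>indicator \<Omega> x * \<phi> x\<bar> \<le> \<bar>B\<bar>"
        using assms(6)[of x] by (auto simp: indicator_def)
      then have "\<bar>indicator \<Omega> x * \<phi> x\<bar> * norm (indicator K x *\<^sub>R f x) \<le> \<bar>B\<bar> * norm (indicator K x *\<^sub>R f x)"
        by (rule mult_right_mono) simp
      then show "norm (indicator \<Omega> x *\<^sub>R \<phi> x *\<^sub>R f x) \<le> norm (\<bar>B\<bar> *\<^sub>R norm (indicator K x *\<^sub>R f x))"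
        unfolding eq by (simp add: abs_mult mult.assoc)
    qed
  qed
  then show ?thesis
    using assms(4) by (simp add: integrable_restrict_space)
qed

lemma test_function_integrable_scaled:
  fixes f :: "real^2 \<Rightarrow> 'b::{banach,second_countable_topology}"
  assumes "locally_integrable \<Omega> f" "\<Omega> \<in> sets lebesgue" "continuous_on UNIV \<phi>" "{x. \<phi> x \<noteq> 0} \<subset>\<subset> \<Omega>"
  shows "integrable (lebesgue_on \<Omega>) (\<lambda>x. \<phi> x *\<^sub>R f x)"
proof -
  let ?K = "closure {x. \<phi> x \<noteq> 0}"
  have K: "compact ?K" "?K \<subseteq> \<Omega>"
    using assms(4) by (auto simp: compactly_contained_def)
  have "bounded (\<phi> ` ?K)"
    using K(1) assms(3) by (intro compact_imp_bounded compact_continuous_image) (auto intro: continuous_on_subset)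
  then obtain B where B: "\<And>x. x \<in> ?K \<Longrightarrow> \<bar>\<phi> x\<bar> \<le> B"
    by (auto simp: bounded_iff)
  have out: "\<phi> x = 0" if "x \<notin> ?K" for x
    using that closure_subset[of "{x. \<phi> x \<noteq> 0}"] by auto
  show ?thesis
  proof (rule locally_integrable_imp_integrable_scaled[OF assms(1) K assms(2)])
    show "\<phi> \<in> borel_measurable lebesgue"
      by (rule continuous_on_UNIV_lebesgue_measurable[OF assms(3)])
    show "\<bar>\<phi> x\<bar> \<le> max B 0" for x
      using B[of x] out[of x] by (cases "x \<in> ?K") auto
  qed (rule out)
qed

text \<open>Dominated convergence replaces test functions by indicators of boxes, the box criterion
  gives vanishing a.e. on each closed box inside \<Omega>, and countably many closed boxes cover
  \<Omega>.\<close>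

lemma fundamental_lemma_calculus_of_variations:
  fixes g :: "real^2 \<Rightarrow> real"
  assumes G: "smooth_step G" and \<Omega>: "open \<Omega>" and g: "locally_integrable \<Omega> g"
    and test: "\<And>\<phi>. \<phi> \<in> test_functions \<Omega> \<Longrightarrow> (LINT x|lebesgue_on \<Omega>. g x * \<phi> x) = 0"
  shows "AE x in lebesgue_on \<Omega>. g x = 0"
proof -
  have \<Omega>_sets: "\<Omega> \<in> sets lebesgue" using \<Omega> by auto
  have int_box: "integrable (lebesgue_on \<Omega>) (\<lambda>x. indicator (box a b) x *\<^sub>R g x)" if ab: "cbox a b \<subseteq> \<Omega>" for a b
  proof (rule locally_integrable_imp_integrable_scaled[OF g compact_cbox[of a b] ab \<Omega>_sets, where B = 1])
    show "indicat_real (box a b) \<in> borel_measurable lebesgue"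
      by (rule borel_measurable_indicator) simp
  qed (use box_subset_cbox[of a b] in \<open>auto simp: indicator_def\<close>)
  have box0: "(LINT x|lebesgue. indicator (box a b) x * g x) = 0" if ab: "cbox a b \<subseteq> \<Omega>" for a b
  proof -
    obtain \<phi> :: "nat \<Rightarrow> real^2 \<Rightarrow> real" where \<phi>: "\<And>n. \<phi> n \<in> test_functions \<Omega>"
      "\<And>n x. \<phi> n x \<in> {0..1}" "\<And>n x. x \<notin> box a b \<Longrightarrow> \<phi> n x = 0"
      "\<And>x. (\<lambda>n. \<phi> n x) \<longlonglongrightarrow> indicator (box a b) x"
      using smooth_step_box_approximation[OF G ab] by blast
    have cont: "\<phi> n \<in> borel_measurable lebesgue" for n
    proof -
      have "continuous_on UNIV (\<phi> n)"
        by (rule test_functions_continuous[OF \<phi>(1)])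
      then show ?thesis
        by (rule continuous_on_UNIV_lebesgue_measurable)
    qed
    have prod_int: "integrable (lebesgue_on \<Omega>) (\<lambda>x. \<phi> n x *\<^sub>R g x)" for n
      using box_subset_cbox[of a b] \<phi>(2)[of n] \<phi>(3)[of _ n]
      by (intro locally_integrable_imp_integrable_scaled[OF g compact_cbox[of a b] ab \<Omega>_sets cont, where B = 1])
         auto
    have "(\<lambda>n. LINT x|lebesgue_on \<Omega>. \<phi> n x *\<^sub>R g x) \<longlonglongrightarrow> (LINT x|lebesgue_on \<Omega>. indicator (box a b) x *\<^sub>R g x)"
    proof (rule integral_dominated_convergence)
      show "integrable (lebesgue_on \<Omega>) (\<lambda>x. norm (indicator (box a b) x *\<^sub>R g x))"
        using int_box[OF ab] by (rule integrable_norm)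
      show "AE x in lebesgue_on \<Omega>. (\<lambda>n. \<phi> n x *\<^sub>R g x) \<longlonglongrightarrow> indicator (box a b) x *\<^sub>R g x"
        by (intro AE_I2 tendsto_scaleR \<phi>(4) tendsto_const)
      show "AE x in lebesgue_on \<Omega>. norm (\<phi> n x *\<^sub>R g x) \<le> norm (indicator (box a b) x *\<^sub>R g x)" for n
      proof (rule AE_I2)
        fix x
        show "norm (\<phi> n x *\<^sub>R g x) \<le> norm (indicator (box a b) x *\<^sub>R g x)"
          using \<phi>(2)[of n x] \<phi>(3)[of x n] by (cases "x \<in> box a b") (auto simp: abs_mult intro: mult_left_le_one_le)
      qed
    qed (use prod_int int_box[OF ab] borel_measurable_integrable in blast)+
    moreover have "(LINT x|lebesgue_on \<Omega>. \<phi> n x *\<^sub>R g x) = 0" for n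
      using test[OF \<phi>(1)[of n]] by (simp add: mult.commute)
    ultimately have "(LINT x|lebesgue_on \<Omega>. indicator (box a b) x *\<^sub>R g x) = 0"
      by (simp add: LIMSEQ_const_iff)
    moreover have "indicator \<Omega> x * (indicator (box a b) x * g x) = indicator (box a b) x * g x" for x
      using ab box_subset_cbox[of a b] by (auto simp: indicator_def)
    ultimately show ?thesis
      using \<Omega>_sets by (simp add: integral_restrict_space)
  qed
  have AE_box: "AE x in lebesgue. x \<in> cbox a b \<longrightarrow> g x = 0" if ab: "cbox a b \<subseteq> \<Omega>" for a b
  proof -
    have "AE x in lebesgue. indicator (box a b) x * g x = 0"
    proof (rule AE_zero_of_box_integrals_zero)
      have "(\<lambda>x. indicator \<Omega> x * (indicator (box a b) x * g x)) = (\<lambda>x. indicator (box a b) x * g x)"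
        using ab box_subset_cbox[of a b] by (intro ext) (auto simp: indicator_def)
      then show "integrable lebesgue (\<lambda>x. indicator (box a b) x * g x)"
        using int_box[OF ab] \<Omega>_sets by (simp only: integrable_restrict_space real_scaleR_def space_completion
            space_lborel space_borel Int_UNIV_right)
      fix c d :: "real^2"
      obtain p q where pq: "box c d \<inter> box a b = box p q"
        by (rule that[OF box_Int_box])
      have eq: "indicator (box c d) x * (indicator (box a b) x * g x) = indicator (box p q) x * g x" for x
        unfolding pq[symmetric] by (simp add: indicator_inter_arith)
      show "(LINT x|lebesgue. indicator (box c d) x * (indicator (box a b) x * g x)) = 0"
      proof (cases "box p q = {}")
        case False
        \<comment> \<open>Nonemptiness matters: only then is the closure of \<open>box p q\<close>
          equal to \<open>cbox p q\<close>, and \<open>box0\<close> requires the closed box to lie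
          in \<Omega>.\<close>
        then have "cbox p q \<subseteq> cbox a b"
          using pq by (metis closure_box closure_minimal closed_cbox box_subset_cbox inf_le2 order_trans)
        then show ?thesis
          using box0[of p q] ab by (simp add: eq)
      qed (simp add: eq)
    qed
    \<comment> \<open>The criterion controls the open box, whereas the covering of \<Omega> below
      consists of closed ones; the faces are a null set.\<close>
    moreover have "AE x in lebesgue. x \<notin> cbox a b - box a b"
      by (rule AE_not_in) (use negligible_frontier_interval[of a b] in \<open>simp only: negligible_iff_null_sets\<close>)
    ultimately show ?thesis
      by eventually_elim (auto simp: indicator_def)
  qed
  obtain D where D: "countable D" "D \<subseteq> Pow \<Omega>" "\<And>X. X \<in> D \<Longrightarrow> \<exists>a b. X = cbox a b" "\<Union>D = \<Omega>"
    using open_countable_Union_open_cbox[OF \<Omega>] by metis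
  have "AE x in lebesgue. \<forall>X\<in>D. x \<in> X \<longrightarrow> g x = 0"
  proof (rule AE_ball_countable[OF D(1), THEN iffD2], rule ballI)
    fix X assume "X \<in> D"
    then show "AE x in lebesgue. x \<in> X \<longrightarrow> g x = 0"
      using D(2,3) AE_box by blast
  qed
  then show ?thesis
    using \<Omega>_sets D(4) by (auto simp: AE_restrict_space_iff elim!: eventually_mono)
qed

section \<open>Derivatives of test functions\<close>

lemma smooth_on_UNIV_has_derivative:
  "smooth_on UNIV \<psi> \<Longrightarrow> (\<psi> has_derivative frechet_derivative \<psi> (at x)) (at x)"
  unfolding smooth_on_def using C_k_on_SucD(1)[of UNIV 0 \<psi> x] by simp

lemma smooth_on_UNIV_continuous_derivative:
  "smooth_on UNIV \<psi> \<Longrightarrow> continuous_on UNIV (\<lambda>x. frechet_derivative \<psi> (at x) v)"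
  unfolding smooth_on_def using C_k_on_SucD(2)[of UNIV 0 \<psi> v] by (metis C_k_on.simps(1) open_UNIV)

lemma continuous_on_gradient:
  "smooth_on UNIV \<psi> \<Longrightarrow> continuous_on UNIV (\<lambda>x. gradient \<psi> x $ j)"
  by (simp add: gradient_def smooth_on_UNIV_continuous_derivative)

lemma frechet_derivative_zero_outside_support:
  assumes "x \<notin> closure {x. \<psi> x \<noteq> 0}"
  shows "frechet_derivative \<psi> (at x) = (\<lambda>v. 0)"
proof -
  have "(\<psi> has_derivative (\<lambda>v. 0)) (at x)"
  proof (rule has_derivative_transform_within_open[of "\<lambda>x. 0"])
    show "open (- closure {x. \<psi> x \<noteq> 0})" by auto
    show "0 = \<psi> y" if "y \<in> - closure {x. \<psi> x \<noteq> 0}" for y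
      using that closure_subset[of "{x. \<psi> x \<noteq> 0}"] by auto
  qed (use assms in auto)
  then show ?thesis by (metis frechet_derivative_at)
qed

lemma gradient_zero_outside_support:
  "x \<notin> closure {x. \<psi> x \<noteq> 0} \<Longrightarrow> gradient \<psi> x = 0"
  by (simp add: gradient_def frechet_derivative_zero_outside_support vec_eq_iff)

lemma compactly_contained_subset:
  assumes "A \<subseteq> closure B" "B \<subset>\<subset> \<Omega>"
  shows "A \<subset>\<subset> \<Omega>"
proof -
  have "closure A \<subseteq> closure B"
    using assms(1) by (simp add: closure_minimal)
  then show ?thesis
    using assms(2) compact_Int_closed[of "closure B" "closure A"]
    by (auto simp: compactly_contained_def Int_absorb1)
qed

lemma gradient_support:
  assumes "{x. \<psi> x \<noteq> 0} \<subset>\<subset> \<Omega>"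
  shows "{x. gradient \<psi> x $ j \<noteq> 0} \<subset>\<subset> \<Omega>"
  by (rule compactly_contained_subset[OF _ assms])
     (use gradient_zero_outside_support[of _ \<psi>] in fastforce)

text \<open>By translation invariance the difference quotients of a test function integrate to \<open>0\<close>.\<close>

lemma integral_directional_derivative_zero:
  fixes \<psi> :: "'a::euclidean_space \<Rightarrow> real"
  assumes "smooth_on UNIV \<psi>" "compact (closure {x. \<psi> x \<noteq> 0})"
  shows "(LINT x|lborel. frechet_derivative \<psi> (at x) e) = 0"
proof -
  let ?K = "closure {x. \<psi> x \<noteq> 0}"
  let ?D = "\<lambda>x. frechet_derivative \<psi> (at x) e"
  let ?h = "\<lambda>n. 1 / real (Suc n)"
  let ?s = "\<lambda>n x. real (Suc n) * (\<psi> (x + ?h n *\<^sub>R e) - \<psi> x)"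
  have contD: "continuous_on UNIV ?D"
    using assms(1) by (rule smooth_on_UNIV_continuous_derivative)
  have cont\<psi>: "continuous_on UNIV \<psi>"
    using assms(1) by (rule smooth_on_imp_continuous_on)
  note [measurable] = borel_measurable_continuous_onI[OF contD] borel_measurable_continuous_onI[OF cont\<psi>]
  \<comment> \<open>The derivative is continuous and vanishes off the compact support, which makes
    it globally bounded.\<close>
  obtain C where C: "\<bar>?D x\<bar> \<le> C" "C \<ge> 0" for x
  proof -
    have "bounded (?D ` ?K)"
      using assms(2) contD by (intro compact_imp_bounded compact_continuous_image) (auto intro: continuous_on_subset)
    then obtain B where B: "\<And>x. x \<in> ?K \<Longrightarrow> \<bar>?D x\<bar> \<le> B"
      by (auto simp: bounded_iff)
    have "\<bar>?D x\<bar> \<le> max B 0" for x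
    proof (cases "x \<in> ?K")
      case False
      show ?thesis
        unfolding frechet_derivative_zero_outside_support[OF False] by simp
    qed (use B[of x] in simp)
    then show thesis using that by (meson max.cobounded2)
  qed
  obtain M where M: "\<And>x. x \<in> ?K \<Longrightarrow> norm x \<le> M"
    using assms(2) by (meson bounded_iff compact_imp_bounded)
  have z: "\<psi> x = 0" if "norm x > M" for x
    using M[of x] that closure_subset[of "{x. \<psi> x \<noteq> 0}"] by force
  \<comment> \<open>The mean value theorem along the segment in direction \<open>e\<close> bounds
    all difference quotients by the bound for the derivative.\<close>
  have bound: "\<bar>?s n x\<bar> \<le> C" for n x
  proof -
    have "\<exists>t\<in>{0<..<?h n}. norm (\<psi> (x + ?h n *\<^sub>R e) - \<psi> (x + 0 *\<^sub>R e)) \<le>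
        norm ((\<lambda>s. s * ?D (x + t *\<^sub>R e)) (?h n - 0))"
    proof (rule mvt_general[where f = "\<lambda>t. \<psi> (x + t *\<^sub>R e)" and f' = "\<lambda>t s. s * ?D (x + t *\<^sub>R e)"])
      show "continuous_on {0..?h n} (\<lambda>t. \<psi> (x + t *\<^sub>R e))"
        by (rule continuous_on_compose2[OF cont\<psi>]) (auto intro!: continuous_intros)
      fix t
      have D: "(\<psi> has_derivative frechet_derivative \<psi> (at (x + t *\<^sub>R e))) (at (x + t *\<^sub>R e))"
        using assms(1) by (rule smooth_on_UNIV_has_derivative)
      have "((\<lambda>t. x + t *\<^sub>R e) has_derivative (\<lambda>s. s *\<^sub>R e)) (at t)"
        by (auto intro!: derivative_eq_intros)
      from has_derivative_compose[OF this D] 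
      show "((\<lambda>t. \<psi> (x + t *\<^sub>R e)) has_derivative (\<lambda>s. s * ?D (x + t *\<^sub>R e))) (at t)"
        by (simp add: linear_scale[OF has_derivative_linear[OF D]])
    qed simp
    then obtain t where "\<bar>\<psi> (x + ?h n *\<^sub>R e) - \<psi> x\<bar> \<le> ?h n * \<bar>?D (x + t *\<^sub>R e)\<bar>"
      by (auto simp: abs_mult)
    also have "\<dots> \<le> ?h n * C"
      by (rule mult_left_mono[OF C(1)]) simp
    finally have "real (Suc n) * \<bar>\<psi> (x + ?h n *\<^sub>R e) - \<psi> x\<bar> \<le> C"
      by (simp add: field_simps)
    then show ?thesis by (simp add: abs_mult)
  qed
  \<comment> \<open>Each shift has length at most \<open>norm e\<close>, so all difference quotients
    live in one ball; \<open>C\<close> times its indicator is the dominating function.\<close>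
  have s0: "?s n x = 0" if "x \<notin> cball 0 (M + norm e)" for n x
  proof -
    have x: "norm x > M + norm e" using that by simp
    have "norm (?h n *\<^sub>R e) \<le> norm e"
      by (simp add: divide_le_eq mult_left_le mult_le_cancel_left1 algebra_simps)
    then have "norm (x + ?h n *\<^sub>R e) > M"
      using x norm_diff_ineq[of x "?h n *\<^sub>R e"] by linarith
    moreover have "norm x > M" using x norm_ge_zero[of e] by linarith
    ultimately show ?thesis using z by simp
  qed
  have int: "integrable lborel \<psi>"
  proof -
    have "integrable lborel (\<lambda>x. indicator ?K x *\<^sub>R \<psi> x)"
      by (rule borel_integrable_compact[OF assms(2) continuous_on_subset[OF cont\<psi> subset_UNIV]])
    moreover have "(\<lambda>x. indicator ?K x *\<^sub>R \<psi> x) = \<psi>"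
      using closure_subset[of "{x. \<psi> x \<noteq> 0}"] by (intro ext) (auto simp: indicator_def)
    ultimately show ?thesis by (simp only:)
  qed
  have "(\<lambda>n. LINT x|lborel. ?s n x) \<longlonglongrightarrow> (LINT x|lborel. ?D x)"
  proof (rule integral_dominated_convergence)
    show "integrable lborel (\<lambda>x. C * indicator (cball (0::'a) (M + norm e)) x)"
      by (intro integrable_mult_right integrable_real_indicator) (use emeasure_bounded_finite[OF bounded_cball] in auto)
    show "AE x in lborel. (\<lambda>n. ?s n x) \<longlonglongrightarrow> ?D x"
    proof (rule AE_I2)
      fix x
      have D: "(\<psi> has_derivative frechet_derivative \<psi> (at x)) (at x)"
        using assms(1) by (rule smooth_on_UNIV_has_derivative)
      have lin: "((\<lambda>t. x + t *\<^sub>R e) has_derivative (\<lambda>s. s *\<^sub>R e)) (at 0)"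
        by (auto intro!: derivative_eq_intros)
      have "((\<lambda>t. \<psi> (x + t *\<^sub>R e)) has_derivative (\<lambda>s. s * ?D x)) (at 0)"
        using has_derivative_compose[OF lin, of \<psi> "frechet_derivative \<psi> (at x)"] D
        by (simp add: linear_scale[OF has_derivative_linear[OF D]])
      then have "((\<lambda>t. \<psi> (x + t *\<^sub>R e)) has_real_derivative ?D x) (at 0)"
        by (simp add: has_field_derivative_def mult_commute_abs)
      then have "((\<lambda>h. (\<psi> (x + h *\<^sub>R e) - \<psi> x) / h) \<longlongrightarrow> ?D x) (at 0)"
        by (simp add: DERIV_def)
      moreover have "filterlim ?h (at 0) sequentially"
        using LIMSEQ_Suc[OF lim_1_over_n[where ?'a = real]] by (auto simp: filterlim_at)
      ultimately have "(\<lambda>n. (\<psi> (x + ?h n *\<^sub>R e) - \<psi> x) / ?h n) \<longlonglongrightarrow> ?D x"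
        by (rule filterlim_compose)
      then show "(\<lambda>n. ?s n x) \<longlonglongrightarrow> ?D x"
        by (simp add: mult.commute)
    qed
    show "AE x in lborel. norm (?s n x) \<le> C * indicator (cball (0::'a) (M + norm e)) x" for n
    proof (rule AE_I2)
      fix x
      show "norm (?s n x) \<le> C * indicator (cball (0::'a) (M + norm e)) x"
        using bound[of n x] s0[of x n] by (cases "x \<in> cball 0 (M + norm e)") (simp_all del: of_nat_Suc)
    qed
  qed measurable
  moreover have "(LINT x|lborel. ?s n x) = 0" for n
  proof -
    have tr: "integrable lborel (\<lambda>x. \<psi> (?h n *\<^sub>R e + x))"
      "(LINT x|lborel. \<psi> (?h n *\<^sub>R e + x)) = (LINT x|lborel. \<psi> x)"
      using integrable_distr_eq[of "\<lambda>x. ?h n *\<^sub>R e + x" lborel borel \<psi>]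
        integral_distr[of "\<lambda>x. ?h n *\<^sub>R e + x" lborel borel \<psi>] int
      by (simp_all add: lborel_distr_plus del: of_nat_Suc)
    then show ?thesis
      using int by (simp add: add.commute[of _ "_ *\<^sub>R e"] del: of_nat_Suc)
  qed
  ultimately show ?thesis
    by (simp add: LIMSEQ_const_iff)
qed

section \<open>Local integrability and the calculus of weak gradients\<close>

lemma locally_integrable_bounded_linear:
  assumes "bounded_linear T" "locally_integrable \<Omega> f"
  shows "locally_integrable \<Omega> (\<lambda>x. T (f x))"
  using assms(2) integrable_bounded_linear[OF assms(1)] unfolding locally_integrable_def by blast

lemma locally_integrable_component:
  fixes f :: "real^2 \<Rightarrow> real^2" and D :: "real^2 \<Rightarrow> real^2^2"
  shows "locally_integrable \<Omega> f \<Longrightarrow> locally_integrable \<Omega> (\<lambda>x. f x $ i)"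
    and "locally_integrable \<Omega> D \<Longrightarrow> locally_integrable \<Omega> (\<lambda>x. D x $ i $ j)"
  by (auto intro: locally_integrable_bounded_linear[OF bounded_linear_vec_nth]
      locally_integrable_bounded_linear[OF bounded_linear_compose[OF bounded_linear_vec_nth bounded_linear_vec_nth]])

lemma locally_integrable_add:
  "locally_integrable \<Omega> f \<Longrightarrow> locally_integrable \<Omega> g \<Longrightarrow> locally_integrable \<Omega> (\<lambda>x. f x + g x)"
  unfolding locally_integrable_def by (auto intro: Bochner_Integration.integrable_add)

lemma locally_integrable_diff:
  "locally_integrable \<Omega> f \<Longrightarrow> locally_integrable \<Omega> g \<Longrightarrow> locally_integrable \<Omega> (\<lambda>x. f x - g x)"
  unfolding locally_integrable_def by (auto intro: Bochner_Integration.integrable_diff)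

lemma locally_integrable_const: "locally_integrable \<Omega> (\<lambda>x. c)"
  unfolding locally_integrable_def
proof (intro allI impI)
  fix K :: "(real^2) set" assume "compact K \<and> K \<subseteq> \<Omega>"
  then have "emeasure lebesgue K < \<infinity>" "K \<in> sets lebesgue"
    using lmeasurable_compact[of K] by (auto simp: fmeasurable_def)
  then show "integrable (lebesgue_on K) (\<lambda>x. c)"
    by (intro finite_measure.integrable_const finite_measureI) (simp add: emeasure_restrict_space)
qed

lemma locally_integrable_scaleR_continuous:
  fixes f :: "real^2 \<Rightarrow> 'b::{banach,second_countable_topology}"
  assumes "locally_integrable \<Omega> f" "continuous_on UNIV \<phi>"
  shows "locally_integrable \<Omega> (\<lambda>x. \<phi> x *\<^sub>R f x)"
  unfolding locally_integrable_def
proof (intro allI impI)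
  fix K assume K: "compact K \<and> K \<subseteq> \<Omega>"
  then have "bounded (\<phi> ` K)"
    using assms(2) by (intro compact_imp_bounded compact_continuous_image) (auto intro: continuous_on_subset)
  then obtain B where "\<And>x. x \<in> K \<Longrightarrow> \<bar>\<phi> x\<bar> \<le> B"
    by (auto simp: bounded_iff)
  moreover have "K \<in> sets lebesgue"
    using K lmeasurable_compact[of K] by (auto simp: fmeasurable_def)
  moreover have "locally_integrable K f"
    using assms(1) K by (auto simp: locally_integrable_def)
  ultimately show "integrable (lebesgue_on K) (\<lambda>x. \<phi> x *\<^sub>R f x)"
    using K continuous_on_UNIV_lebesgue_measurable[OF assms(2)]
    by (intro locally_integrable_imp_integrable_scaled[where K = K]) auto
qed

text \<open>Measurability is known on each compact piece, and an open set is a countable union of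
  closed boxes.\<close>

lemma locally_integrable_borel_measurable:
  fixes f :: "real^2 \<Rightarrow> 'b::{banach,second_countable_topology}"
  assumes "locally_integrable \<Omega> f" "open \<Omega>"
  shows "f \<in> borel_measurable (lebesgue_on \<Omega>)"
proof -
  obtain D where D: "countable D" "D \<subseteq> Pow \<Omega>" "\<And>X. X \<in> D \<Longrightarrow> \<exists>a b. X = cbox a b" "\<Union>D = \<Omega>"
    using open_countable_Union_open_cbox[OF assms(2)] by metis
  have sets: "X \<in> sets lebesgue" if "X \<in> D" for X
    using D(3)[OF that] by auto
  show ?thesis
  proof (rule measurable_piecewise_restrict[OF D(1)])
    fix X assume X: "X \<in> D"
    show "X \<inter> space (lebesgue_on \<Omega>) \<in> sets (lebesgue_on \<Omega>)"
      using sets[OF X] by (auto simp: sets_restrict_space)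
    have "compact X" "X \<subseteq> \<Omega>"
      using D(2) D(3)[OF X] X by auto
    then have "integrable (lebesgue_on X) f"
      using assms(1) by (auto simp: locally_integrable_def)
    moreover have "restrict_space (lebesgue_on \<Omega>) X = lebesgue_on X"
      using restrict_restrict_space[of \<Omega> lebesgue X] assms(2) sets[OF X] \<open>X \<subseteq> \<Omega>\<close>
      by (simp add: Int_absorb1)
    ultimately show "f \<in> borel_measurable (restrict_space (lebesgue_on \<Omega>) X)"
      by simp
  qed (use D in auto)
qed

lemma weak_gradient_integrable:
  assumes "is_weak_gradient \<Omega> u A" "open \<Omega>" "\<phi> \<in> test_functions \<Omega>"
  shows "integrable (lebesgue_on \<Omega>) (\<lambda>x. u x $ i * gradient \<phi> x $ j)"
    and "integrable (lebesgue_on \<Omega>) (\<lambda>x. A x $ i $ j * \<phi> x)"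
proof -
  have \<phi>: "smooth_on UNIV \<phi>" "{x. \<phi> x \<noteq> 0} \<subset>\<subset> \<Omega>"
    using assms(3) by (auto simp: test_functions_def)
  have u: "locally_integrable \<Omega> (\<lambda>x. u x $ i)" and A: "locally_integrable \<Omega> (\<lambda>x. A x $ i $ j)"
    using assms(1) by (auto simp: is_weak_gradient_def intro: locally_integrable_component)
  have \<Omega>: "\<Omega> \<in> sets lebesgue" using assms(2) by auto
  show "integrable (lebesgue_on \<Omega>) (\<lambda>x. u x $ i * gradient \<phi> x $ j)"
    using test_function_integrable_scaled[OF u \<Omega> continuous_on_gradient[OF \<phi>(1), of j] gradient_support[OF \<phi>(2)]]
    by (simp add: mult.commute)
  show "integrable (lebesgue_on \<Omega>) (\<lambda>x. A x $ i $ j * \<phi> x)"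
    using test_function_integrable_scaled[OF A \<Omega> smooth_on_imp_continuous_on[OF \<phi>(1)] \<phi>(2)]
    by (simp add: mult.commute)
qed

lemma weak_gradient_AE_unique:
  assumes G: "smooth_step G" and "open \<Omega>" "is_weak_gradient \<Omega> u A" "is_weak_gradient \<Omega> u B"
  shows "AE x in lebesgue_on \<Omega>. A x = B x"
proof -
  have "AE x in lebesgue_on \<Omega>. A x $ i $ j - B x $ i $ j = 0" for i j
  proof (rule fundamental_lemma_calculus_of_variations[OF G assms(2)])
    show "locally_integrable \<Omega> (\<lambda>x. A x $ i $ j - B x $ i $ j)"
      using assms(3,4) by (auto simp: is_weak_gradient_def intro: locally_integrable_diff locally_integrable_component)
    fix \<phi> assume \<phi>: "\<phi> \<in> test_functions \<Omega>"
    have "(LINT x|lebesgue_on \<Omega>. u x $ i * gradient \<phi> x $ j) = - (LINT x|lebesgue_on \<Omega>. A x $ i $ j * \<phi> x)"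
      "(LINT x|lebesgue_on \<Omega>. u x $ i * gradient \<phi> x $ j) = - (LINT x|lebesgue_on \<Omega>. B x $ i $ j * \<phi> x)"
      using assms(3,4) \<phi> by (auto simp: is_weak_gradient_def)
    then have "(LINT x|lebesgue_on \<Omega>. A x $ i $ j * \<phi> x) = (LINT x|lebesgue_on \<Omega>. B x $ i $ j * \<phi> x)"
      by linarith
    then show "(LINT x|lebesgue_on \<Omega>. (A x $ i $ j - B x $ i $ j) * \<phi> x) = 0"
      using weak_gradient_integrable(2)[OF assms(3,2) \<phi>, of i j] weak_gradient_integrable(2)[OF assms(4,2) \<phi>, of i j]
      by (simp add: left_diff_distrib)
  qed
  then have "AE x in lebesgue_on \<Omega>. \<forall>i j. A x $ i $ j - B x $ i $ j = 0"
    unfolding AE_all_countable by blast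
  then show ?thesis
    by eventually_elim (simp add: vec_eq_iff)
qed

lemma weak_gradient_add:
  assumes "open \<Omega>" "is_weak_gradient \<Omega> u A" "is_weak_gradient \<Omega> v B"
  shows "is_weak_gradient \<Omega> (\<lambda>x. u x + v x) (\<lambda>x. A x + B x)"
  unfolding is_weak_gradient_def
proof (intro conjI ballI allI)
  show "locally_integrable \<Omega> (\<lambda>x. u x + v x)" "locally_integrable \<Omega> (\<lambda>x. A x + B x)"
    using assms by (auto simp: is_weak_gradient_def intro: locally_integrable_add)
  fix \<phi> i j assume \<phi>: "\<phi> \<in> test_functions \<Omega>"
  have "(LINT x|lebesgue_on \<Omega>. u x $ i * gradient \<phi> x $ j) = - (LINT x|lebesgue_on \<Omega>. A x $ i $ j * \<phi> x)"
    "(LINT x|lebesgue_on \<Omega>. v x $ i * gradient \<phi> x $ j) = - (LINT x|lebesgue_on \<Omega>. B x $ i $ j * \<phi> x)"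
    using assms(2,3) \<phi> by (auto simp: is_weak_gradient_def)
  then show "(LINT x|lebesgue_on \<Omega>. (u x + v x) $ i * gradient \<phi> x $ j) =
      - (LINT x|lebesgue_on \<Omega>. (A x + B x) $ i $ j * \<phi> x)"
    using weak_gradient_integrable[OF assms(2,1) \<phi>, of i j] weak_gradient_integrable[OF assms(3,1) \<phi>, of i j]
    by (simp add: distrib_right)
qed

text \<open>This amounts to the vanishing integral of a partial derivative of a test function; it
  justifies subtracting \<open>a\<close> from \<open>u\<close>.\<close>

lemma weak_gradient_const:
  assumes "open \<Omega>"
  shows "is_weak_gradient \<Omega> (\<lambda>x. a) (\<lambda>x. 0)"
  unfolding is_weak_gradient_def
proof (intro conjI ballI allI locally_integrable_const)
  fix \<phi> and i j :: 2 assume \<phi>: "\<phi> \<in> test_functions \<Omega>"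
  have "smooth_on UNIV \<phi>" and K: "compact (closure {x. \<phi> x \<noteq> 0})" "closure {x. \<phi> x \<noteq> 0} \<subseteq> \<Omega>"
    using \<phi> by (auto simp: test_functions_def compactly_contained_def)
  have "(LINT x|lebesgue_on \<Omega>. gradient \<phi> x $ j) = (LINT x|lebesgue. indicator \<Omega> x *\<^sub>R gradient \<phi> x $ j)"
    using assms by (simp add: integral_restrict_space)
  also have "\<dots> = (LINT x|lebesgue. gradient \<phi> x $ j)"
  proof (rule Bochner_Integration.integral_cong)
    show "indicator \<Omega> x *\<^sub>R gradient \<phi> x $ j = gradient \<phi> x $ j" for x
    proof (cases "x \<in> \<Omega>")
      case False
      then have "gradient \<phi> x = 0"
        using gradient_zero_outside_support K(2) by blast
      then show ?thesis by simp
    qed simp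
  qed simp
  also have "\<dots> = (LINT x|lborel. gradient \<phi> x $ j)"
    using continuous_on_gradient[OF \<open>smooth_on UNIV \<phi>\<close>]
    by (intro integral_completion) (simp add: borel_measurable_continuous_onI)
  also have "\<dots> = 0"
    using integral_directional_derivative_zero[OF \<open>smooth_on UNIV \<phi>\<close> K(1)] by (simp add: gradient_def)
  finally show "(LINT x|lebesgue_on \<Omega>. a $ i * gradient \<phi> x $ j) = - (LINT x|lebesgue_on \<Omega>. 0 $ i $ j * \<phi> x)"
    by simp
qed

lemma gradient_mult:
  assumes "smooth_on UNIV \<zeta>" "smooth_on UNIV \<phi>"
  shows "gradient (\<lambda>y. \<zeta> y * \<phi> y) x $ j = \<zeta> x * gradient \<phi> x $ j + gradient \<zeta> x $ j * \<phi> x"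
proof -
  have "((\<lambda>x. \<zeta> x * \<phi> x) has_derivative
      (\<lambda>v. \<zeta> x * frechet_derivative \<phi> (at x) v + frechet_derivative \<zeta> (at x) v * \<phi> x)) (at x)"
    using assms by (intro has_derivative_mult smooth_on_UNIV_has_derivative)
  from frechet_derivative_at[OF this, symmetric] show ?thesis
    by (simp add: gradient_def)
qed

text \<open>If \<phi> is a test function then so is \<zeta>\<phi>. Testing the weak gradient of
  \<open>w\<close> with \<zeta>\<phi> and moving the term with the gradient of \<zeta> to the other
  side gives the product rule.\<close>

lemma weak_gradient_mult:
  assumes "open \<Omega>" "is_weak_gradient \<Omega> w A" "smooth_on UNIV \<zeta>"
  shows "is_weak_gradient \<Omega> (\<lambda>x. \<zeta> x *\<^sub>R w x) (\<lambda>x. \<zeta> x *\<^sub>R A x + w x \<otimes>\<^sub>v gradient \<zeta> x)"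
  unfolding is_weak_gradient_def
proof (intro conjI ballI allI)
  have w: "locally_integrable \<Omega> w" and A: "locally_integrable \<Omega> A"
    using assms(2) by (auto simp: is_weak_gradient_def)
  have cont: "continuous_on UNIV \<zeta>"
    using assms(3) by (rule smooth_on_imp_continuous_on)
  show "locally_integrable \<Omega> (\<lambda>x. \<zeta> x *\<^sub>R w x)"
    by (rule locally_integrable_scaleR_continuous[OF w cont])
  \<comment> \<open>The tensor is expanded in the columns: each summand is a continuous scalar times
    a fixed linear image of \<open>w\<close>, and both operations preserve local
    integrability.\<close>
  have "locally_integrable \<Omega> (\<lambda>x. \<Sum>j\<in>UNIV. gradient \<zeta> x $ j *\<^sub>R (w x \<otimes>\<^sub>v axis j 1))"
  proof -
    have "locally_integrable \<Omega> (\<lambda>x. gradient \<zeta> x $ j *\<^sub>R (w x \<otimes>\<^sub>v axis j 1))" for j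
    proof (rule locally_integrable_scaleR_continuous[OF _ continuous_on_gradient[OF assms(3)]])
      have "linear (\<lambda>p::real^2. p \<otimes>\<^sub>v axis j 1)"
        by (rule linearI) (simp_all add: tensor_def vec_eq_iff distrib_right)
      then show "locally_integrable \<Omega> (\<lambda>x. w x \<otimes>\<^sub>v axis j 1)"
        using locally_integrable_bounded_linear[OF _ w] linear_conv_bounded_linear by blast
    qed
    then show ?thesis
      by (simp add: sum_2 locally_integrable_add)
  qed
  moreover have "(\<Sum>j\<in>UNIV. gradient \<zeta> x $ j *\<^sub>R (w x \<otimes>\<^sub>v axis j 1)) = w x \<otimes>\<^sub>v gradient \<zeta> x" for x
    by (simp add: tensor_def vec_eq_iff sum_2 forall_2 axis_def)
  ultimately show "locally_integrable \<Omega> (\<lambda>x. \<zeta> x *\<^sub>R A x + w x \<otimes>\<^sub>v gradient \<zeta> x)"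
    using locally_integrable_add[OF locally_integrable_scaleR_continuous[OF A cont]] by auto
  fix \<phi> i j assume \<phi>: "\<phi> \<in> test_functions \<Omega>"
  have \<phi>': "smooth_on UNIV \<phi>" "{x. \<phi> x \<noteq> 0} \<subset>\<subset> \<Omega>"
    using \<phi> by (auto simp: test_functions_def)
  have \<zeta>\<phi>: "(\<lambda>x. \<zeta> x * \<phi> x) \<in> test_functions \<Omega>"
    using smooth_on_mult[OF open_UNIV assms(3) \<phi>'(1)]
      compactly_contained_subset[OF _ \<phi>'(2), of "{x. \<zeta> x * \<phi> x \<noteq> 0}"] closure_subset[of "{x. \<phi> x \<noteq> 0}"]
    by (auto simp: test_functions_def)
  have 1: "(LINT x|lebesgue_on \<Omega>. w x $ i * gradient (\<lambda>y. \<zeta> y * \<phi> y) x $ j) =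
      - (LINT x|lebesgue_on \<Omega>. A x $ i $ j * (\<zeta> x * \<phi> x))"
    using assms(2) \<zeta>\<phi> by (auto simp: is_weak_gradient_def)
  have I1: "integrable (lebesgue_on \<Omega>) (\<lambda>x. w x $ i * gradient (\<lambda>y. \<zeta> y * \<phi> y) x $ j)"
    and I2: "integrable (lebesgue_on \<Omega>) (\<lambda>x. A x $ i $ j * (\<zeta> x * \<phi> x))"
    by (rule weak_gradient_integrable[OF assms(2,1) \<zeta>\<phi>])+
  have "integrable (lebesgue_on \<Omega>) (\<lambda>x. \<phi> x *\<^sub>R (gradient \<zeta> x $ j *\<^sub>R w x $ i))"
    using assms(1) by (intro test_function_integrable_scaled locally_integrable_scaleR_continuous
        locally_integrable_component w continuous_on_gradient assms(3) smooth_on_imp_continuous_on \<phi>') auto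
  then have I3: "integrable (lebesgue_on \<Omega>) (\<lambda>x. w x $ i * gradient \<zeta> x $ j * \<phi> x)"
    by (simp add: mult_ac)
  have "(LINT x|lebesgue_on \<Omega>. (\<zeta> x *\<^sub>R w x) $ i * gradient \<phi> x $ j) =
      (LINT x|lebesgue_on \<Omega>. w x $ i * gradient (\<lambda>y. \<zeta> y * \<phi> y) x $ j - w x $ i * gradient \<zeta> x $ j * \<phi> x)"
    by (rule Bochner_Integration.integral_cong) (simp_all only: gradient_mult[OF assms(3) \<phi>'(1)], simp add: algebra_simps)
  also have "\<dots> = - ((LINT x|lebesgue_on \<Omega>. A x $ i $ j * (\<zeta> x * \<phi> x)) + (LINT x|lebesgue_on \<Omega>. w x $ i * gradient \<zeta> x $ j * \<phi> x))"
    using I1 I3 1 by simp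
  also have "\<dots> = - (LINT x|lebesgue_on \<Omega>. A x $ i $ j * (\<zeta> x * \<phi> x) + w x $ i * gradient \<zeta> x $ j * \<phi> x)"
    using I2 I3 by simp
  also have "\<dots> = - (LINT x|lebesgue_on \<Omega>. (\<zeta> x *\<^sub>R A x + w x \<otimes>\<^sub>v gradient \<zeta> x) $ i $ j * \<phi> x)"
    by (intro arg_cong[where f = uminus] Bochner_Integration.integral_cong) (simp_all add: tensor_def algebra_simps)
  finally show "(LINT x|lebesgue_on \<Omega>. (\<zeta> x *\<^sub>R w x) $ i * gradient \<phi> x $ j) =
      - (LINT x|lebesgue_on \<Omega>. (\<zeta> x *\<^sub>R A x + w x \<otimes>\<^sub>v gradient \<zeta> x) $ i $ j * \<phi> x)" .
qed

lemma weak_gradient_cutoff: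
  assumes "open \<Omega>" "is_weak_gradient \<Omega> u A" "smooth_on UNIV \<zeta>"
  shows "is_weak_gradient \<Omega> (\<lambda>x. \<zeta> x *\<^sub>R (u x - a)) (\<lambda>x. \<zeta> x *\<^sub>R A x + (u x - a) \<otimes>\<^sub>v gradient \<zeta> x)"
proof -
  have "is_weak_gradient \<Omega> (\<lambda>x. u x - a) A"
    using weak_gradient_add[OF assms(1,2) weak_gradient_const[OF assms(1), of "- a"]] by simp
  then show ?thesis
    by (rule weak_gradient_mult[OF assms(1) _ assms(3)])
qed

section \<open>Square integrability, the chosen weak gradient, and traces\<close>

lemma L2_on_add:
  assumes "L2_on \<Omega> f" "L2_on \<Omega> g"
  shows "L2_on \<Omega> (\<lambda>x. f x + g x)"
  unfolding L2_on_def
proof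
  have m: "f \<in> borel_measurable (lebesgue_on \<Omega>)" "g \<in> borel_measurable (lebesgue_on \<Omega>)"
    using assms by (auto simp: L2_on_def)
  then show m': "(\<lambda>x. f x + g x) \<in> borel_measurable (lebesgue_on \<Omega>)"
    by (rule borel_measurable_add)
  show "integrable (lebesgue_on \<Omega>) (\<lambda>x. (norm (f x + g x))\<^sup>2)"
  proof (rule Bochner_Integration.integrable_bound)
    show "integrable (lebesgue_on \<Omega>) (\<lambda>x. 2 * (norm (f x))\<^sup>2 + 2 * (norm (g x))\<^sup>2)"
      using assms by (auto simp: L2_on_def)
    have "(norm (f x + g x))\<^sup>2 \<le> 2 * (norm (f x))\<^sup>2 + 2 * (norm (g x))\<^sup>2" for x
    proof -
      have "(norm (f x + g x))\<^sup>2 \<le> (norm (f x) + norm (g x))\<^sup>2"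
        by (intro power_mono norm_triangle_ineq norm_ge_zero)
      also have "\<dots> \<le> 2 * (norm (f x))\<^sup>2 + 2 * (norm (g x))\<^sup>2"
        using sum_squares_bound[of "norm (f x)" "norm (g x)"] by (simp add: power2_sum)
      finally show ?thesis .
    qed
    then show "AE x in lebesgue_on \<Omega>. norm ((norm (f x + g x))\<^sup>2) \<le> norm (2 * (norm (f x))\<^sup>2 + 2 * (norm (g x))\<^sup>2)"
      by (intro AE_I2) auto
  qed (use m' in measurable)
qed

lemma L2_on_scaleR_bounded:
  assumes "L2_on \<Omega> f" "\<phi> \<in> borel_measurable (lebesgue_on \<Omega>)" "\<And>x. x \<in> \<Omega> \<Longrightarrow> \<bar>\<phi> x\<bar> \<le> B"
  shows "L2_on \<Omega> (\<lambda>x. \<phi> x *\<^sub>R f x)"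
  unfolding L2_on_def
proof
  show m': "(\<lambda>x. \<phi> x *\<^sub>R f x) \<in> borel_measurable (lebesgue_on \<Omega>)"
    using assms(1,2) by (auto simp: L2_on_def intro: borel_measurable_scaleR)
  show "integrable (lebesgue_on \<Omega>) (\<lambda>x. (norm (\<phi> x *\<^sub>R f x))\<^sup>2)"
  proof (rule Bochner_Integration.integrable_bound)
    show "integrable (lebesgue_on \<Omega>) (\<lambda>x. B\<^sup>2 * (norm (f x))\<^sup>2)"
      using assms by (auto simp: L2_on_def)
    show "AE x in lebesgue_on \<Omega>. norm ((norm (\<phi> x *\<^sub>R f x))\<^sup>2) \<le> norm (B\<^sup>2 * (norm (f x))\<^sup>2)"
    proof (rule AE_I2)
      fix x assume "x \<in> space (lebesgue_on \<Omega>)"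
      then have "\<bar>\<phi> x\<bar> \<le> B" using assms(3) by (simp add: space_restrict_space)
      then have "\<bar>\<phi> x\<bar>\<^sup>2 \<le> B\<^sup>2" by (intro power_mono) auto
      then show "norm ((norm (\<phi> x *\<^sub>R f x))\<^sup>2) \<le> norm (B\<^sup>2 * (norm (f x))\<^sup>2)"
        by (simp add: power_mult_distrib mult_right_mono)
    qed
  qed (use m' in measurable)
qed

lemma lebesgue_on_finite_measure:
  "bounded \<Omega> \<Longrightarrow> \<Omega> \<in> sets lebesgue \<Longrightarrow> finite_measure (lebesgue_on \<Omega>)"
  for \<Omega> :: "'a::euclidean_space set"
  using fmeasurableD2[OF bounded_set_imp_lmeasurable[of \<Omega>]]
  by (intro finite_measureI) (simp add: emeasure_restrict_space)

lemma L2_on_bounded: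
  assumes "bounded \<Omega>" "\<Omega> \<in> sets lebesgue" "f \<in> borel_measurable (lebesgue_on \<Omega>)"
    and "\<And>x. x \<in> \<Omega> \<Longrightarrow> norm (f x) \<le> B"
  shows "L2_on \<Omega> f"
  unfolding L2_on_def
proof
  show "integrable (lebesgue_on \<Omega>) (\<lambda>x. (norm (f x))\<^sup>2)"
  proof (rule finite_measure.integrable_const_bound[where B = "B\<^sup>2"])
    show "AE x in lebesgue_on \<Omega>. norm ((norm (f x))\<^sup>2) \<le> B\<^sup>2"
      using assms(4) by (intro AE_I2) (auto simp: space_restrict_space intro: power_mono)
  qed (use assms in \<open>auto intro: lebesgue_on_finite_measure\<close>)
qed fact

lemma wgrad_is_weak_gradient: "is_weak_gradient \<Omega> u A \<Longrightarrow> is_weak_gradient \<Omega> u (wgrad \<Omega> u)"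
  unfolding wgrad_def by (rule someI[of "is_weak_gradient \<Omega> u"])

lemma wgrad_AE_eq:
  "smooth_step G \<Longrightarrow> open \<Omega> \<Longrightarrow> is_weak_gradient \<Omega> u A \<Longrightarrow> AE x in lebesgue_on \<Omega>. wgrad \<Omega> u x = A x"
  using weak_gradient_AE_unique wgrad_is_weak_gradient by blast

lemma wgrad_borel_measurable:
  "open \<Omega> \<Longrightarrow> is_weak_gradient \<Omega> u A \<Longrightarrow> wgrad \<Omega> u \<in> borel_measurable (lebesgue_on \<Omega>)"
  using wgrad_is_weak_gradient[of \<Omega> u A] by (auto simp: is_weak_gradient_def intro: locally_integrable_borel_measurable)

text \<open>Membership in \<open>W12\<close> supplies some square integrable weak gradient, but
  \<open>wgrad\<close> may have picked another one; uniqueness a.e. transfers the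
  integrability.\<close>

lemma wgrad_L2:
  assumes "smooth_step G" "open \<Omega>" "u \<in> W12 \<Omega>"
  shows "is_weak_gradient \<Omega> u (wgrad \<Omega> u)" "L2_on \<Omega> (wgrad \<Omega> u)"
proof -
  obtain A where A: "is_weak_gradient \<Omega> u A" "L2_on \<Omega> A"
    using assms(3) by (auto simp: W12_def)
  show "is_weak_gradient \<Omega> u (wgrad \<Omega> u)"
    using A(1) by (rule wgrad_is_weak_gradient)
  have m: "wgrad \<Omega> u \<in> borel_measurable (lebesgue_on \<Omega>)"
    using assms(2) A(1) by (rule wgrad_borel_measurable)
  have "integrable (lebesgue_on \<Omega>) (\<lambda>x. (norm (wgrad \<Omega> u x))\<^sup>2)"
  proof (rule integrable_cong_AE_imp)
    show "integrable (lebesgue_on \<Omega>) (\<lambda>x. (norm (A x))\<^sup>2)"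
      using A(2) by (simp add: L2_on_def)
    show "AE x in lebesgue_on \<Omega>. (norm (A x))\<^sup>2 = (norm (wgrad \<Omega> u x))\<^sup>2"
      using wgrad_AE_eq[OF assms(1,2) A(1)] by eventually_elim simp
  qed (use m in measurable)
  then show "L2_on \<Omega> (wgrad \<Omega> u)"
    using m by (simp add: L2_on_def)
qed

lemma W12_add:
  assumes "open \<Omega>" "u \<in> W12 \<Omega>" "v \<in> W12 \<Omega>"
  shows "(\<lambda>x. u x + v x) \<in> W12 \<Omega>"
proof -
  obtain A B where "is_weak_gradient \<Omega> u A" "L2_on \<Omega> A" "is_weak_gradient \<Omega> v B" "L2_on \<Omega> B"
    using assms(2,3) by (auto simp: W12_def)
  then have "is_weak_gradient \<Omega> (\<lambda>x. u x + v x) (\<lambda>x. A x + B x)" "L2_on \<Omega> (\<lambda>x. A x + B x)"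
    by (auto intro: weak_gradient_add[OF assms(1)] L2_on_add)
  moreover have "L2_on \<Omega> (\<lambda>x. u x + v x)"
    using assms(2,3) by (auto simp: W12_def intro: L2_on_add)
  ultimately show ?thesis
    by (auto simp: W12_def)
qed

text \<open>Adding the same \<rho> to every approximating map leaves the differences w_n - u
  unchanged, and on the boundary it changes nothing. Thus the competitor keeps the boundary values
  without any continuity of the trace operator.\<close>

lemma has_trace_add_zero_boundary:
  assumes "open \<Omega>" "has_trace \<Omega> u g" "\<rho> \<in> W12 \<Omega>" "continuous_on (closure \<Omega>) \<rho>"
    and "\<And>x. x \<in> frontier \<Omega> \<Longrightarrow> \<rho> x = 0"
  shows "has_trace \<Omega> (\<lambda>x. u x + \<rho> x) g"
proof -
  obtain w where w: "\<And>n::nat. w n \<in> W12 \<Omega>" "\<And>n. continuous_on (closure \<Omega>) (w n)"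
    "(\<lambda>n. W12_norm \<Omega> (\<lambda>x. w n x - u x)) \<longlonglongrightarrow> 0"
    "(\<lambda>n. \<integral>\<^sup>+x\<in>frontier \<Omega>. ennreal ((norm (w n x - g x))\<^sup>2) \<partial>H1) \<longlonglongrightarrow> 0"
    using assms(2) by (auto simp: has_trace_def)
  have "ennreal ((norm (w n x + \<rho> x - g x))\<^sup>2) * indicator (frontier \<Omega>) x =
      ennreal ((norm (w n x - g x))\<^sup>2) * indicator (frontier \<Omega>) x" for n x
    using assms(5)[of x] by (auto simp: indicator_def)
  moreover have "w n x + \<rho> x - (u x + \<rho> x) = w n x - u x" for n x
    by simp
  ultimately show ?thesis
    unfolding has_trace_def using w W12_add[OF assms(1) w(1) assms(3)] continuous_on_add[OF w(2) assms(4)]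
    by (intro exI[of _ "\<lambda>n x. w n x + \<rho> x"]) simp
qed

section \<open>Convexity and growth of h\<close>

text \<open>Used at the two breakpoints of h, where the branches meet with equal one-sided
  derivatives.\<close>

lemma has_real_derivative_split_at:
  fixes f :: "real \<Rightarrow> real"
  assumes "(f has_real_derivative D) (at x within {a..x})" "(f has_real_derivative D) (at x within {x..b})"
    and "a < x" "x < b"
  shows "(f has_real_derivative D) (at x)"
proof -
  have "(f has_real_derivative D) (at x within {a..x} \<union> {x..b})"
    using assms(1,2) unfolding has_field_derivative_iff unfolding at_within_union by (rule filterlim_sup)
  moreover have "{a..x} \<union> {x..b} = {a..b}"
    using assms(3,4) by auto
  ultimately show ?thesis
    using assms(3,4) by (simp add: at_within_Icc_at)
qed

text \<open>By the mean value theorem the slope of the chord is a value of \<open>p\<close> between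
  the two points, and monotonicity compares it with \<open>p t\<close>. The slope belongs to the end
  point \<open>t\<close>, which is what turns convexity into an upper bound.\<close>

lemma convex_tangent_bound:
  fixes H p :: "real \<Rightarrow> real"
  assumes D: "\<And>s. s > 0 \<Longrightarrow> (H has_real_derivative p s) (at s)"
    and mono: "\<And>s t. 0 < s \<Longrightarrow> s \<le> t \<Longrightarrow> p s \<le> p t" and "s > 0" "t > 0"
  shows "H t - H s \<le> p t * (t - s)"
proof (cases s t rule: linorder_cases)
  case less
  obtain q where "s < q" "q < t" "H t - H s = (t - s) * p q"
    using MVT2[OF less, of H p] D \<open>s > 0\<close> by (metis less_le_trans)
  moreover have "p q \<le> p t"
    using mono[of q t] \<open>s > 0\<close> \<open>s < q\<close> \<open>q < t\<close> by simp
  ultimately show ?thesis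
    using less by (simp add: mult.commute mult_left_mono)
next
  case greater
  obtain q where "t < q" "q < s" "H s - H t = (s - t) * p q"
    using MVT2[OF greater, of H p] D \<open>t > 0\<close> by (metis less_le_trans)
  moreover have "p t \<le> p q"
    using mono[of t q] \<open>t > 0\<close> \<open>t < q\<close> by simp
  ultimately show ?thesis
    using greater mult_left_mono[of "p t" "p q" "s - t"] by (simp add: algebra_simps)
qed simp

text \<open>All that the variational argument uses about h. The bound by \<open>l\<close> is
  monotonicity together with the linear branch. For the last bound, -h'(s) s equals 1 up to
  \<open>c\<^sub>1\<close>, is at most \<open>s / c\<^sub>1\<close> between \<open>c\<^sub>1\<close>
  and 1 by monotonicity, and is nonpositive from 1 on.\<close>

lemma h_fun_derivative:
  assumes "h_data \<theta> c\<^sub>1 c\<^sub>2 l m" and h: "h = h_fun \<theta> c\<^sub>1 c\<^sub>2 l m"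
  shows "\<And>s. s > 0 \<Longrightarrow> ((\<lambda>s. enn2real (h s)) has_real_derivative h_deriv h s) (at s)"
    and "\<And>s t. 0 < s \<Longrightarrow> s \<le> t \<Longrightarrow> h_deriv h s \<le> h_deriv h t"
    and "continuous_on {0<..} (h_deriv h)"
    and "h_deriv h 1 = 0"
    and "\<And>s. s > 0 \<Longrightarrow> h_deriv h s \<le> l"
    and "\<And>s. s > 0 \<Longrightarrow> - h_deriv h s * s \<le> 1 / c\<^sub>1"
proof -
  have c: "l > 0" "m > 0" "0 < c\<^sub>1" "c\<^sub>1 < 1" "1 < c\<^sub>2"
    and \<theta>_pos: "\<And>s. s \<in> {c\<^sub>1..c\<^sub>2} \<Longrightarrow> \<theta> s > 0"
    and C2: "C_k_on 2 {c\<^sub>1<..<c\<^sub>2} \<theta>" and \<theta>'': "\<And>s. s \<in> {c\<^sub>1<..<c\<^sub>2} \<Longrightarrow> deriv (deriv \<theta>) s > 0"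
    and C1: "C_k_on 1 {c\<^sub>1..c\<^sub>2} \<theta>"
    and \<theta>_ends: "\<theta> c\<^sub>1 = \<bar>ln c\<^sub>1\<bar>" "\<theta> c\<^sub>2 = l * c\<^sub>2 + m"
    and \<theta>_c\<^sub>1: "(\<theta> has_real_derivative (- 1 / c\<^sub>1)) (at c\<^sub>1 within {c\<^sub>1..c\<^sub>2})"
    and \<theta>_c\<^sub>2: "(\<theta> has_real_derivative l) (at c\<^sub>2 within {c\<^sub>1..c\<^sub>2})"
    and \<theta>_1: "(\<theta> has_real_derivative 0) (at 1)"
    using assms(1) unfolding h_data_def by blast+
  \<comment> \<open>The derivative within the closed interval, so that the one-sided endpoint values
    belong to the same continuous function as the interior ones.\<close>
  define g where "g = (\<lambda>s. frechet_derivative \<theta> (at s within {c\<^sub>1..c\<^sub>2}) 1)"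
  have g_cont: "continuous_on {c\<^sub>1..c\<^sub>2} g"
    using C1 by (simp add: g_def)
  have g_D: "(\<theta> has_real_derivative g s) (at s within {c\<^sub>1..c\<^sub>2})" if "s \<in> {c\<^sub>1..c\<^sub>2}" for s
  proof -
    have D: "(\<theta> has_derivative frechet_derivative \<theta> (at s within {c\<^sub>1..c\<^sub>2})) (at s within {c\<^sub>1..c\<^sub>2})"
      using C1 that by (simp add: differentiable_on_def frechet_derivative_works)
    have "frechet_derivative \<theta> (at s within {c\<^sub>1..c\<^sub>2}) = (*) (g s)"
    proof
      show "frechet_derivative \<theta> (at s within {c\<^sub>1..c\<^sub>2}) t = g s * t" for t
        using linear_scale[OF has_derivative_linear[OF D], of t 1] by (simp add: g_def mult.commute)
    qed
    then show ?thesis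
      unfolding has_field_derivative_def by (rule has_derivative_eq_rhs[OF D])
  qed
  have g_unique: "g s = D" if "(\<theta> has_real_derivative D) (at s within {c\<^sub>1..c\<^sub>2})" "s \<in> {c\<^sub>1..c\<^sub>2}" for s D
  proof -
    have "(*) (g s) = (*) D"
      using frechet_derivative_unique_within_closed_interval[of c\<^sub>1 c\<^sub>2 s \<theta> "(*) (g s)" "(*) D"] g_D that c
      by (simp add: has_field_derivative_def box_real)
    then show ?thesis by (metis mult.right_neutral)
  qed
  have g_ends: "g c\<^sub>1 = - 1 / c\<^sub>1" "g c\<^sub>2 = l" "g 1 = 0"
    using g_unique[OF \<theta>_c\<^sub>1] g_unique[OF \<theta>_c\<^sub>2] g_unique[OF has_field_derivative_at_within[OF \<theta>_1]] c
    by auto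
  have at: "(\<theta> has_real_derivative g s) (at s)" if "s \<in> {c\<^sub>1<..<c\<^sub>2}" for s
    using g_D[of s] that by (simp add: at_within_Icc_at)
  \<comment> \<open>The second derivative exists in the open interval only; continuity of
    \<open>g\<close> up to the endpoints extends the monotonicity to the closed one.\<close>
  have g_mono: "g s \<le> g t" if "c\<^sub>1 \<le> s" "s \<le> t" "t \<le> c\<^sub>2" for s t
  proof (rule DERIV_nonneg_imp_increasing_open[OF that(2)])
    show "continuous_on {s..t} g"
      using g_cont that by (auto intro: continuous_on_subset)
    fix x assume x: "s < x" "x < t"
    then have xS: "x \<in> {c\<^sub>1<..<c\<^sub>2}" using that by auto
    have fd: "frechet_derivative \<theta> (at y) 1 = deriv \<theta> y" if "y \<in> {c\<^sub>1<..<c\<^sub>2}" for y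
      using at[OF that] frechet_derivative_at[of \<theta> "(*) (g y)" y] DERIV_imp_deriv[OF at[OF that]]
      by (simp add: has_field_derivative_def) (metis mult.right_neutral)
    have "C_k_on (Suc 0) {c\<^sub>1<..<c\<^sub>2} (\<lambda>x. frechet_derivative \<theta> (at x) 1)"
      using C_k_on_SucD(2)[of "{c\<^sub>1<..<c\<^sub>2}" "Suc 0" \<theta> 1] C2 by (simp only: numeral_2_eq_2 open_greaterThanLessThan)
    then have "C_k_on (Suc 0) {c\<^sub>1<..<c\<^sub>2} (deriv \<theta>)"
      by (rule C_k_on_cong[OF open_greaterThanLessThan fd, THEN iffD1, rotated])
    then have "deriv \<theta> differentiable (at x)"
      unfolding differentiable_def using C_k_on_SucD(1)[OF open_greaterThanLessThan _ xS] by blast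
    then have "(deriv \<theta> has_real_derivative deriv (deriv \<theta>) x) (at x)"
      by (metis DERIV_imp_deriv real_differentiable_def)
    then have "(g has_real_derivative deriv (deriv \<theta>) x) (at x)"
      by (rule has_field_derivative_transform_within_open[OF _ open_greaterThanLessThan xS])
         (use at in \<open>simp add: DERIV_imp_deriv\<close>)
    then show "\<exists>y. (g has_real_derivative y) (at x) \<and> 0 \<le> y"
      using \<theta>''[OF xS] by (auto intro: less_imp_le)
  qed
  \<comment> \<open>All three branches of \<open>h'\<close> in one formula, so that continuity and monotonicity need no cases.\<close>
  define p where "p = (\<lambda>s. 1 / c\<^sub>1 - 1 / min s c\<^sub>1 + g (max c\<^sub>1 (min s c\<^sub>2)))"
  have p1: "p s = - 1 / s" if "0 < s" "s \<le> c\<^sub>1" for s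
    using that c g_ends by (cases "s = c\<^sub>1") (simp_all add: p_def min_def max_def)
  have p2: "p s = g s" if "c\<^sub>1 \<le> s" "s \<le> c\<^sub>2" for s
    using that by (simp add: p_def min_def max_def)
  have p3: "p s = l" if "c\<^sub>2 \<le> s" for s
    using that c g_ends by (simp add: p_def min_def max_def)
  define H where "H = (\<lambda>s. enn2real (h s))"
  have H1: "H s = - ln s" if "0 < s" "s \<le> c\<^sub>1" for s
    using that c \<theta>_ends by (cases "s = c\<^sub>1") (auto simp: H_def h h_fun_def)
  have H2: "H s = \<theta> s" if "c\<^sub>1 \<le> s" "s \<le> c\<^sub>2" for s
    using that c \<theta>_pos[of s] by (auto simp: H_def h h_fun_def)
  have H3: "H s = l * s + m" if "c\<^sub>2 \<le> s" for s
  proof -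
    have "h s = ennreal (l * s + m)"
      using that c \<theta>_ends by (cases "s = c\<^sub>2") (auto simp: h h_fun_def simp del: ennreal_plus)
    then show ?thesis using that c by (simp add: H_def del: ennreal_plus)
  qed
  \<comment> \<open>The end \<open>s/2\<close> merely provides a left neighbourhood of
    \<open>s\<close> inside the positive axis; \<open>s+1\<close> provides the right neighbourhood
    in \<open>HD3\<close>.\<close>
  have HD1: "(H has_real_derivative p s) (at s within {s/2..c\<^sub>1})" if "0 < s" "s \<le> c\<^sub>1" for s
  proof (rule has_field_derivative_transform_within[where d = 1 and f = "\<lambda>s. - ln s"])
    show "((\<lambda>s. - ln s) has_real_derivative p s) (at s within {s/2..c\<^sub>1})"
      using has_field_derivative_at_within[OF DERIV_minus[OF DERIV_ln_divide[OF that(1)]], of "{s/2..c\<^sub>1}"] p1[OF that]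
      by simp
  qed (use that H1 in auto)
  have HD2: "(H has_real_derivative p s) (at s within {c\<^sub>1..c\<^sub>2})" if "c\<^sub>1 \<le> s" "s \<le> c\<^sub>2" for s
    by (rule has_field_derivative_transform_within[where d = 1 and f = \<theta>]) (use that g_D[of s] H2 p2 in auto)
  have HD3: "(H has_real_derivative p s) (at s within {c\<^sub>2..s+1})" if "c\<^sub>2 \<le> s" for s
  proof (rule has_field_derivative_transform_within[where d = 1 and f = "\<lambda>s. l * s + m"])
    show "((\<lambda>s. l * s + m) has_real_derivative p s) (at s within {c\<^sub>2..s+1})"
      using p3[OF that] by (auto intro!: derivative_eq_intros)
  qed (use that H3 in auto)
  have HD: "(H has_real_derivative p s) (at s)" if "s > 0" for s
  proof -
    consider "s < c\<^sub>1" | "s = c\<^sub>1" | "c\<^sub>1 < s" "s < c\<^sub>2" | "s = c\<^sub>2" | "s > c\<^sub>2" by linarith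
    then show ?thesis
    proof cases
      case 1 then show ?thesis using HD1[of s] that by (simp add: at_within_Icc_at)
    next
      case 2 then show ?thesis
        using HD1[of s] HD2[of s] c by (intro has_real_derivative_split_at[where a = "s/2" and b = c\<^sub>2]) auto
    next
      case 3 then show ?thesis using HD2[of s] by (simp add: at_within_Icc_at)
    next
      case 4 then show ?thesis
        using HD2[of s] HD3[of s] c by (intro has_real_derivative_split_at[where a = c\<^sub>1 and b = "s+1"]) auto
    next
      case 5 then show ?thesis using HD3[of s] by (simp add: at_within_Icc_at)
    qed
  qed
  have hp: "h_deriv h s = p s" if "s > 0" for s
    using HD[OF that] by (simp add: h_deriv_def H_def DERIV_imp_deriv)
  show "((\<lambda>s. enn2real (h s)) has_real_derivative h_deriv h s) (at s)" if "s > 0" for s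
    using HD[OF that] hp[OF that] by (simp add: H_def)
  have mono: "p s \<le> p t" if "0 < s" "s \<le> t" for s t
  proof -
    have "1 / min t c\<^sub>1 \<le> 1 / min s c\<^sub>1"
      using that c by (intro divide_left_mono mult_pos_pos) auto
    moreover have "g (max c\<^sub>1 (min s c\<^sub>2)) \<le> g (max c\<^sub>1 (min t c\<^sub>2))"
      using that c by (intro g_mono) auto
    ultimately show ?thesis by (simp add: p_def)
  qed
  then show "h_deriv h s \<le> h_deriv h t" if "0 < s" "s \<le> t" for s t
    using that hp[of s] hp[of t] by simp
  have "continuous_on {0<..} p"
    unfolding p_def
  proof (intro continuous_intros)
    show "continuous_on {0<..} (\<lambda>s. g (max c\<^sub>1 (min s c\<^sub>2)))"
      by (rule continuous_on_compose2[OF g_cont]) (use c in \<open>auto intro!: continuous_intros\<close>)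
  qed (use c in auto)
  then show "continuous_on {0<..} (h_deriv h)"
    using hp by (subst continuous_on_cong[OF refl, of _ _ p]) auto
  show "h_deriv h 1 = 0"
    using hp[of 1] p2[of 1] g_ends c by simp
  show "h_deriv h s \<le> l" if "s > 0" for s
    using hp[OF that] mono[of s "max s c\<^sub>2"] p3[of "max s c\<^sub>2"] that by simp
  show "- h_deriv h s * s \<le> 1 / c\<^sub>1" if "s > 0" for s
  proof -
    consider "s \<le> c\<^sub>1" | "c\<^sub>1 < s" "s < 1" | "s \<ge> 1" by linarith
    then show ?thesis
    proof cases
      case 1
      then show ?thesis using hp[OF that] p1[of s] that c by simp
    next
      case 2
      then have "- p s \<le> 1 / c\<^sub>1"
        using mono[of c\<^sub>1 s] p1[of c\<^sub>1] c by simp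
      then have "- p s * s \<le> 1 / c\<^sub>1 * 1"
        using 2 that c by (intro mult_mono) auto
      then show ?thesis using hp[OF that] by simp
    next
      case 3
      then have "p s \<ge> 0"
        using mono[of 1 s] p2[of 1] g_ends c by simp
      then have "- p s * s \<le> 0" using that by simp
      also have "0 \<le> 1 / c\<^sub>1" using c by simp
      finally show ?thesis using hp[OF that] by simp
    qed
  qed
qed

section \<open>The first variation of the energy\<close>

text \<open>The 2 by 2 determinant is a quadratic form whose polar form pairs one matrix with the
  cofactor of the other. The matrix here is k A - \<epsilon> Q with k = 1 - \<epsilon> z, and the
  term in the square of \<epsilon> carries \<open>det Q\<close>.\<close>

lemma det_perturbation:
  fixes A Q :: "real^2^2"
  assumes "det Q = 0"
  shows "det (A - \<epsilon> *\<^sub>R (z *\<^sub>R A + Q)) = (1 - \<epsilon> * z)\<^sup>2 * det A + \<epsilon> * (1 - \<epsilon> * z) * (- (cof A \<bullet> Q))"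
proof -
  have "det (A - \<epsilon> *\<^sub>R (z *\<^sub>R A + Q)) =
      (1 - \<epsilon> * z)\<^sup>2 * det A + \<epsilon> * (1 - \<epsilon> * z) * (- (cof A \<bullet> Q)) + \<epsilon>\<^sup>2 * det Q"
    by (simp add: det_2 cof_def inner_vec_def sum_2 power2_eq_square algebra_simps)
  then show ?thesis using assms by simp
qed

lemma norm_cof: "norm (cof A) = norm A"
  by (simp add: norm_eq_sqrt_inner cof_def inner_vec_def sum_2 algebra_simps)

text \<open>The pointwise core: \<open>d\<close> and \<open>e\<close> play the determinants before
  and after the perturbation, \<open>\<tau>\<close> the nonnegative twist term. The second claim
  controls the increment by first-order terms of one sign; the third dominates these terms
  independently of \<epsilon>.\<close>

lemma energy_density_increment:
  fixes H p :: "real \<Rightarrow> real"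
  assumes D: "\<And>s. s > 0 \<Longrightarrow> (H has_real_derivative p s) (at s)"
    and mono: "\<And>s t. 0 < s \<Longrightarrow> s \<le> t \<Longrightarrow> p s \<le> p t"
    and l: "l \<ge> 0" "\<And>s. s > 0 \<Longrightarrow> p s \<le> l" and C: "C \<ge> 0" "\<And>s. s > 0 \<Longrightarrow> - p s * s \<le> C"
    and \<epsilon>: "0 < \<epsilon>" "\<epsilon> \<le> 1/2" and z: "0 \<le> z" "z \<le> 1" and d: "d > 0" and \<tau>: "\<tau> \<ge> 0"
  defines "e \<equiv> (1 - \<epsilon> * z)\<^sup>2 * d + \<epsilon> * (1 - \<epsilon> * z) * \<tau>"
  shows "e > 0" "H e - H d \<le> \<epsilon> * (max (p e) 0 * \<tau> + max (- p e) 0 * (2 * z * d))"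
    "max (p e) 0 * \<tau> + max (- p e) 0 * (2 * z * d) \<le> l * \<tau> + 8 * C * z"
proof -
  define k where "k = 1 - \<epsilon> * z"
  have "\<epsilon> * z \<le> 1/2 * 1" using \<epsilon> z by (intro mult_mono) auto
  moreover have "\<epsilon> * z \<ge> 0" using \<epsilon> z by simp
  ultimately have k: "1/2 \<le> k" "k \<le> 1" by (auto simp: k_def)
  have e: "e = k\<^sup>2 * d + \<epsilon> * k * \<tau>" by (simp add: e_def k_def)
  have "(1/2)\<^sup>2 \<le> k\<^sup>2" using k by (intro power_mono) auto
  then have "(1/4) * d \<le> k\<^sup>2 * d" using d by (intro mult_right_mono) (auto simp: power2_eq_square)
  moreover have \<tau>k: "0 \<le> \<epsilon> * k * \<tau>" using \<epsilon> k \<tau> by simp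
  \<comment> \<open>Since k \<ge> 1/2 and the twist term is nonnegative, e \<ge> d/4. This is the
    source of the factor 4 below.\<close>
  ultimately have e4: "d \<le> 4 * e" by (simp add: e)
  then show pos: "e > 0" using d by linarith
  have "k\<^sup>2 \<le> 1" using k by (simp add: power_le_one)
  then have "k\<^sup>2 * d \<le> d" using d by simp
  moreover have "\<epsilon> * k * \<tau> \<le> \<epsilon> * \<tau>" using \<epsilon> k \<tau> by (intro mult_right_mono mult_left_le) auto
  \<comment> \<open>The bound for \<open>p e \<ge> 0\<close>: the shrinking of \<open>d\<close> is
    discarded. For \<open>p e < 0\<close> the bound \<open>low\<close> discards the twist term
    instead.\<close>
  ultimately have up: "e - d \<le> \<epsilon> * \<tau>" by (simp add: e)
  have "k\<^sup>2 = 1 - 2 * (\<epsilon> * z) + (\<epsilon> * z)\<^sup>2" by (simp add: k_def power2_diff)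
  then have "1 - 2 * (\<epsilon> * z) \<le> k\<^sup>2" by simp
  then have "(1 - 2 * (\<epsilon> * z)) * d \<le> k\<^sup>2 * d" using d by (intro mult_right_mono) auto
  then have low: "- (e - d) \<le> \<epsilon> * (2 * z * d)" using \<tau>k by (simp add: e algebra_simps)
  have "H e - H d \<le> p e * (e - d)"
    by (rule convex_tangent_bound[OF D mono d pos])
  also have "\<dots> \<le> \<epsilon> * (max (p e) 0 * \<tau> + max (- p e) 0 * (2 * z * d))"
  proof (cases "p e \<ge> 0")
    case True
    then show ?thesis using mult_left_mono[OF up True] by (simp add: mult_ac)
  next
    case False
    then have "- p e * (- (e - d)) \<le> - p e * (\<epsilon> * (2 * z * d))"
      using low by (intro mult_left_mono) auto
    moreover have "p e * (e - d) = - p e * (- (e - d))" by (simp add: algebra_simps)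
    ultimately have "p e * (e - d) \<le> - p e * (\<epsilon> * (2 * z * d))" by (simp only:)
    then show ?thesis using False by (simp add: mult_ac)
  qed
  finally show "H e - H d \<le> \<epsilon> * (max (p e) 0 * \<tau> + max (- p e) 0 * (2 * z * d))" .
  have "max (p e) 0 * \<tau> \<le> l * \<tau>" using l(1) l(2)[OF pos] \<tau> by (intro mult_right_mono) auto
  moreover have "max (- p e) 0 * (2 * z * d) \<le> 8 * C * z"
  proof (cases "p e \<ge> 0")
    case False
    \<comment> \<open>Replacing \<open>d\<close> by \<open>4 * e\<close> makes the bound on the
      product \<open>- p e * e\<close> applicable; with the factor \<open>2 * z\<close> this yields
      \<open>8 * C * z\<close>.\<close>
    then have "- p e * d \<le> - p e * (4 * e)" using e4 by (intro mult_left_mono) auto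
    also have "\<dots> \<le> 4 * C" using C(2)[OF pos] by (simp add: mult.commute)
    finally have "(- p e * d) * (2 * z) \<le> (4 * C) * (2 * z)" using z by (intro mult_right_mono) auto
    then show ?thesis using False by (simp add: mult_ac)
  qed (use C z in auto)
  ultimately show "max (p e) 0 * \<tau> + max (- p e) 0 * (2 * z * d) \<le> l * \<tau> + 8 * C * z" by linarith
qed

lemma integrable_inner_square_integrable:
  fixes f g :: "'a \<Rightarrow> 'b::euclidean_space"
  assumes [measurable]: "f \<in> borel_measurable M" "g \<in> borel_measurable M"
    and "integrable M (\<lambda>x. (norm (f x))\<^sup>2)" "integrable M (\<lambda>x. (norm (g x))\<^sup>2)"
  shows "integrable M (\<lambda>x. f x \<bullet> g x)"
proof (rule Bochner_Integration.integrable_bound)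
  show "integrable M (\<lambda>x. (norm (f x))\<^sup>2 + (norm (g x))\<^sup>2)"
    using assms by simp
  have "\<bar>f x \<bullet> g x\<bar> \<le> (norm (f x))\<^sup>2 + (norm (g x))\<^sup>2" for x
  proof -
    have "\<bar>f x \<bullet> g x\<bar> \<le> norm (f x) * norm (g x)" by (rule Cauchy_Schwarz_ineq2)
    also have "\<dots> \<le> 2 * norm (f x) * norm (g x)" by simp
    also have "\<dots> \<le> (norm (f x))\<^sup>2 + (norm (g x))\<^sup>2" by (rule sum_squares_bound)
    finally show ?thesis .
  qed
  then show "AE x in M. norm (f x \<bullet> g x) \<le> norm ((norm (f x))\<^sup>2 + (norm (g x))\<^sup>2)"
    by (intro AE_I2) auto
qed measurable

lemma cof_borel_measurable:
  assumes "f \<in> borel_measurable M"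
  shows "(\<lambda>x. cof (f x)) \<in> borel_measurable M"
proof -
  have "linear cof"
    by (rule linearI) (simp_all add: cof_def vec_eq_iff forall_2)
  then have "continuous_on UNIV cof"
    using linear_continuous_on linear_conv_bounded_linear by blast
  then show ?thesis
    using measurable_compose[OF assms borel_measurable_continuous_onI] by blast
qed

lemma det_borel_measurable:
  fixes f :: "'a \<Rightarrow> real^2^2"
  assumes "f \<in> borel_measurable M"
  shows "(\<lambda>x. det (f x)) \<in> borel_measurable M"
proof -
  have "continuous_on UNIV (det :: real^2^2 \<Rightarrow> real)"
    unfolding det_2 by (intro continuous_intros)
  then show ?thesis
    using measurable_compose[OF assms borel_measurable_continuous_onI] by blast
qed

text \<open>
  For \<open>D = \<nabla>u\<close> and \<open>P = (u - a) \<otimes>\<^sub>v \<nabla>\<zeta>\<close> the competitor \<open>D - \<epsilon> (\<zeta> D + P)\<close> is the gradient of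
  \<open>u - \<epsilon> \<zeta> (u - a)\<close>. The increments of \<open>H \<circ> det\<close> are dominated because \<open>- (cof D \<bullet> P) \<ge> 0\<close> keeps its
  determinant above \<open>det D / 4\<close>.
\<close>

lemma first_variation_inequality:
  fixes D P :: "'a \<Rightarrow> real^2^2" and \<zeta> :: "'a \<Rightarrow> real" and H p :: "real \<Rightarrow> real"
  assumes H: "\<And>s. s > 0 \<Longrightarrow> (H has_real_derivative p s) (at s)"
    and mono: "\<And>s t. 0 < s \<Longrightarrow> s \<le> t \<Longrightarrow> p s \<le> p t"
    and l: "l \<ge> 0" "\<And>s. s > 0 \<Longrightarrow> p s \<le> l" and C: "C \<ge> 0" "\<And>s. s > 0 \<Longrightarrow> - p s * s \<le> C"
    and p_cont: "continuous_on {0<..} p" and H_nonneg: "\<And>s. H s \<ge> 0"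
    and Hm[measurable]: "H \<in> borel_measurable borel" and pm[measurable]: "p \<in> borel_measurable borel"
    and Dm[measurable]: "D \<in> borel_measurable M" and Pm[measurable]: "P \<in> borel_measurable M"
    and D2: "integrable M (\<lambda>x. (norm (D x))\<^sup>2)" and P2: "integrable M (\<lambda>x. (norm (P x))\<^sup>2)"
    and \<zeta>[measurable]: "\<zeta> \<in> borel_measurable M" "\<And>x. 0 \<le> \<zeta> x" "\<And>x. \<zeta> x \<le> 1" "integrable M \<zeta>"
    and d: "AE x in M. det (D x) > 0" and \<tau>: "AE x in M. - (cof (D x) \<bullet> P x) \<ge> 0"
    and det0: "\<And>x. det (P x) = 0" and int: "integrable M (\<lambda>x. H (det (D x)))"
    and \<epsilon>\<^sub>0: "\<epsilon>\<^sub>0 > 0"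
    and min: "\<And>\<epsilon>. 0 < \<epsilon> \<Longrightarrow> \<epsilon> \<le> \<epsilon>\<^sub>0 \<Longrightarrow> \<epsilon> \<le> 1/2 \<Longrightarrow>
      AE x in M. det (D x - \<epsilon> *\<^sub>R (\<zeta> x *\<^sub>R D x + P x)) > 0 \<Longrightarrow>
      integrable M (\<lambda>x. lam * (norm (D x - \<epsilon> *\<^sub>R (\<zeta> x *\<^sub>R D x + P x)))\<^sup>2 + H (det (D x - \<epsilon> *\<^sub>R (\<zeta> x *\<^sub>R D x + P x)))) \<Longrightarrow>
      (LINT x|M. lam * (norm (D x))\<^sup>2 + H (det (D x))) \<le>
      (LINT x|M. lam * (norm (D x - \<epsilon> *\<^sub>R (\<zeta> x *\<^sub>R D x + P x)))\<^sup>2 + H (det (D x - \<epsilon> *\<^sub>R (\<zeta> x *\<^sub>R D x + P x))))"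
  shows "integrable M (\<lambda>x. max (p (det (D x))) 0 * - (cof (D x) \<bullet> P x) + max (- p (det (D x))) 0 * (2 * \<zeta> x * det (D x)))"
    and "2 * lam * (LINT x|M. D x \<bullet> (\<zeta> x *\<^sub>R D x + P x)) \<le>
      (LINT x|M. max (p (det (D x))) 0 * - (cof (D x) \<bullet> P x) + max (- p (det (D x))) 0 * (2 * \<zeta> x * det (D x)))"
proof -
  define t where "t = (\<lambda>x. - (cof (D x) \<bullet> P x))"
  define N where "N = (\<lambda>x. \<zeta> x *\<^sub>R D x + P x)"
  define e where "e = (\<lambda>\<epsilon> x. det (D x - \<epsilon> *\<^sub>R N x))"
  \<comment> \<open>\<open>K \<epsilon>\<close> bounds the difference quotient of H along the
    perturbation from above, and \<open>K 0\<close> is the integrand of the conclusion.\<close>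
  define K where "K = (\<lambda>\<epsilon> x. max (p (e \<epsilon> x)) 0 * t x + max (- p (e \<epsilon> x)) 0 * (2 * \<zeta> x * det (D x)))"
  have e: "e \<epsilon> x = (1 - \<epsilon> * \<zeta> x)\<^sup>2 * det (D x) + \<epsilon> * (1 - \<epsilon> * \<zeta> x) * t x" for \<epsilon> x
    unfolding e_def N_def t_def by (rule det_perturbation[OF det0])
  have Nm[measurable]: "N \<in> borel_measurable M" unfolding N_def by measurable
  have tm[measurable]: "t \<in> borel_measurable M"
    unfolding t_def using cof_borel_measurable[OF Dm] by measurable
  have dm[measurable]: "(\<lambda>x. det (D x)) \<in> borel_measurable M"
    using det_borel_measurable[OF Dm] .
  have em[measurable]: "e \<epsilon> \<in> borel_measurable M" for \<epsilon>
    unfolding e by measurable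
  have Km[measurable]: "K \<epsilon> \<in> borel_measurable M" for \<epsilon>
    unfolding K_def by measurable
  have t_int: "integrable M t"
    unfolding t_def using cof_borel_measurable[OF Dm] D2 P2
    by (intro integrable_minus integrable_inner_square_integrable) (auto simp: norm_cof)
  have N2: "integrable M (\<lambda>x. (norm (N x))\<^sup>2)"
  proof (rule Bochner_Integration.integrable_bound)
    show "integrable M (\<lambda>x. 2 * (norm (D x))\<^sup>2 + 2 * (norm (P x))\<^sup>2)"
      using D2 P2 by simp
    have "(norm (N x))\<^sup>2 \<le> 2 * (norm (D x))\<^sup>2 + 2 * (norm (P x))\<^sup>2" for x
    proof -
      have "norm (\<zeta> x *\<^sub>R D x) \<le> norm (D x)"
        using \<zeta>(2,3)[of x] by (simp add: mult_left_le_one_le)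
      then have "norm (N x) \<le> norm (D x) + norm (P x)"
        unfolding N_def using norm_triangle_ineq[of "\<zeta> x *\<^sub>R D x" "P x"] by linarith
      then have "(norm (N x))\<^sup>2 \<le> (norm (D x) + norm (P x))\<^sup>2"
        by (intro power_mono norm_ge_zero)
      also have "\<dots> \<le> 2 * (norm (D x))\<^sup>2 + 2 * (norm (P x))\<^sup>2"
        using sum_squares_bound[of "norm (D x)" "norm (P x)"] by (simp add: power2_sum)
      finally show ?thesis .
    qed
    then show "AE x in M. norm ((norm (N x))\<^sup>2) \<le> norm (2 * (norm (D x))\<^sup>2 + 2 * (norm (P x))\<^sup>2)"
      by (intro AE_I2) auto
  qed measurable
  have DN: "integrable M (\<lambda>x. D x \<bullet> N x)"
    by (rule integrable_inner_square_integrable[OF Dm Nm D2 N2])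
  \<comment> \<open>The dominating function for all \<epsilon> \<le> 1/2: it is free of \<epsilon>
    and of \<open>p\<close>.\<close>
  have w_int: "integrable M (\<lambda>x. l * t x + 8 * C * \<zeta> x)"
    using t_int \<zeta>(4) by simp
  have pw: "AE x in M. 0 < e \<epsilon> x \<and> H (e \<epsilon> x) - H (det (D x)) \<le> \<epsilon> * K \<epsilon> x \<and> K \<epsilon> x \<le> l * t x + 8 * C * \<zeta> x"
    if "0 < \<epsilon>" "\<epsilon> \<le> 1/2" for \<epsilon>
    using d \<tau>
  proof eventually_elim
    case (elim x)
    then have "0 \<le> t x" by (simp add: t_def)
    with energy_density_increment[OF H mono l C that \<zeta>(2,3) elim(1) this, of x]
    show ?case unfolding K_def e by blast
  qed
  have K0: "AE x in M. 0 \<le> K \<epsilon> x" for \<epsilon>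
    using d \<tau> 
    unfolding K_def t_def
    by eventually_elim (intro add_nonneg_nonneg mult_nonneg_nonneg \<zeta>(2), auto)
  have K_bound: "AE x in M. norm (K \<epsilon> x) \<le> l * t x + 8 * C * \<zeta> x" if "0 < \<epsilon>" "\<epsilon> \<le> 1/2" for \<epsilon>
    using pw[OF that] K0[of \<epsilon>] by eventually_elim auto
  have K_int: "integrable M (K \<epsilon>)" if "0 < \<epsilon>" "\<epsilon> \<le> 1/2" for \<epsilon>
  proof (rule Bochner_Integration.integrable_bound[OF w_int Km])
    show "AE x in M. norm (K \<epsilon> x) \<le> norm (l * t x + 8 * C * \<zeta> x)"
      using K_bound[OF that] by eventually_elim auto
  qed
  have norm_exp: "(norm (D x - \<epsilon> *\<^sub>R N x))\<^sup>2 = (norm (D x))\<^sup>2 - 2 * \<epsilon> * (D x \<bullet> N x) + \<epsilon>\<^sup>2 * (norm (N x))\<^sup>2" for \<epsilon> x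
    unfolding power2_norm_eq_inner inner_diff_left inner_diff_right inner_scaleR_left inner_scaleR_right
    by (simp add: inner_commute[of "N x" "D x"] power2_eq_square algebra_simps)
  have step: "2 * lam * (LINT x|M. D x \<bullet> N x) \<le> \<epsilon> * (lam * (LINT x|M. (norm (N x))\<^sup>2)) + (LINT x|M. K \<epsilon> x)"
    if \<epsilon>: "0 < \<epsilon>" "\<epsilon> \<le> 1/2" "\<epsilon> \<le> \<epsilon>\<^sub>0" for \<epsilon>
  proof -
    \<comment> \<open>H is nonnegative, so the upper bound for \<open>H (e \<epsilon> x)\<close> is
      enough for integrability.\<close>
    have He: "integrable M (\<lambda>x. H (e \<epsilon> x))"
    proof (rule Bochner_Integration.integrable_bound)
      show "integrable M (\<lambda>x. H (det (D x)) + \<epsilon> * K \<epsilon> x)"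
        using int K_int[OF \<epsilon>(1,2)] by simp
      show "AE x in M. norm (H (e \<epsilon> x)) \<le> norm (H (det (D x)) + \<epsilon> * K \<epsilon> x)"
        using pw[OF \<epsilon>(1,2)] by eventually_elim (use H_nonneg in \<open>simp add: abs_of_nonneg\<close>, smt (verit))
    qed measurable
    have DN2: "integrable M (\<lambda>x. lam * (norm (D x - \<epsilon> *\<^sub>R N x))\<^sup>2)"
      unfolding norm_exp using D2 DN N2 by simp
    have "(LINT x|M. lam * (norm (D x))\<^sup>2 + H (det (D x))) \<le>
        (LINT x|M. lam * (norm (D x - \<epsilon> *\<^sub>R N x))\<^sup>2 + H (e \<epsilon> x))"
      unfolding e_def N_def
    proof (rule min[OF \<epsilon>(1,3,2)])
      show "AE x in M. 0 < det (D x - \<epsilon> *\<^sub>R (\<zeta> x *\<^sub>R D x + P x))"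
        using pw[OF \<epsilon>(1,2)] unfolding e_def N_def by eventually_elim simp
      show "integrable M (\<lambda>x. lam * (norm (D x - \<epsilon> *\<^sub>R (\<zeta> x *\<^sub>R D x + P x)))\<^sup>2 + H (det (D x - \<epsilon> *\<^sub>R (\<zeta> x *\<^sub>R D x + P x))))"
        using DN2 He unfolding e_def N_def by (rule Bochner_Integration.integrable_add)
    qed
    also have "\<dots> \<le> (LINT x|M. lam * (norm (D x - \<epsilon> *\<^sub>R N x))\<^sup>2 + (H (det (D x)) + \<epsilon> * K \<epsilon> x))"
    proof (rule integral_mono_AE)
      show "AE x in M. lam * (norm (D x - \<epsilon> *\<^sub>R N x))\<^sup>2 + H (e \<epsilon> x) \<le> lam * (norm (D x - \<epsilon> *\<^sub>R N x))\<^sup>2 + (H (det (D x)) + \<epsilon> * K \<epsilon> x)"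
        using pw[OF \<epsilon>(1,2)] by eventually_elim simp
    qed (use DN2 He int K_int[OF \<epsilon>(1,2)] in auto)
    also have "\<dots> = lam * ((LINT x|M. (norm (D x))\<^sup>2) - 2 * \<epsilon> * (LINT x|M. D x \<bullet> N x) + \<epsilon>\<^sup>2 * (LINT x|M. (norm (N x))\<^sup>2))
        + ((LINT x|M. H (det (D x))) + \<epsilon> * (LINT x|M. K \<epsilon> x))"
      unfolding norm_exp using D2 DN N2 int K_int[OF \<epsilon>(1,2)] by simp
    also have "(LINT x|M. lam * (norm (D x))\<^sup>2 + H (det (D x))) = lam * (LINT x|M. (norm (D x))\<^sup>2) + (LINT x|M. H (det (D x)))"
      using D2 int by simp
    \<comment> \<open>The zeroth-order terms cancel, and every remaining term carries a factor
      \<epsilon>.\<close>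
    finally have "\<epsilon> * (2 * lam * (LINT x|M. D x \<bullet> N x)) \<le> \<epsilon> * (\<epsilon> * (lam * (LINT x|M. (norm (N x))\<^sup>2)) + (LINT x|M. K \<epsilon> x))"
      by (simp add: algebra_simps power2_eq_square)
    then show ?thesis using \<epsilon>(1) by simp
  qed
  define E where "E = (\<lambda>n. min (1/2) \<epsilon>\<^sub>0 / real (Suc n))"
  have E: "0 < E n" "E n \<le> 1/2" "E n \<le> \<epsilon>\<^sub>0" for n
  proof -
    have "min (1/2) \<epsilon>\<^sub>0 / real (Suc n) \<le> min (1/2) \<epsilon>\<^sub>0 / 1"
      using \<epsilon>\<^sub>0 by (intro divide_left_mono) auto
    then show "E n \<le> 1/2" "E n \<le> \<epsilon>\<^sub>0" by (auto simp: E_def)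
    show "0 < E n" using \<epsilon>\<^sub>0 by (simp add: E_def)
  qed
  have E0: "E \<longlonglongrightarrow> 0"
    unfolding E_def using LIMSEQ_Suc[OF lim_const_over_n] by blast
  \<comment> \<open>At \<epsilon> = 0 the perturbed determinant is \<open>det (D x)\<close>, which
    is positive a.e., and \<open>p\<close> is continuous at positive points.\<close>
  have K_conv: "AE x in M. (\<lambda>n. K (E n) x) \<longlonglongrightarrow> K 0 x"
    using d
  proof eventually_elim
    case (elim x)
    have "(\<lambda>n. e (E n) x) \<longlonglongrightarrow> e 0 x"
      unfolding e using E0 by (auto intro!: tendsto_eq_intros)
    moreover have "isCont p (e 0 x)"
      using p_cont elim by (simp add: e continuous_on_eq_continuous_at)
    ultimately have "(\<lambda>n. p (e (E n) x)) \<longlonglongrightarrow> p (e 0 x)"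
      by (rule isCont_tendsto_compose[rotated])
    then show ?case unfolding K_def by (intro tendsto_intros)
  qed
  have conv: "(\<lambda>n. LINT x|M. K (E n) x) \<longlonglongrightarrow> (LINT x|M. K 0 x)" and K0_int: "integrable M (K 0)"
    using integral_dominated_convergence[OF Km Km w_int K_conv K_bound[OF E(1,2)]]
      integrable_dominated_convergence[OF Km Km w_int K_conv K_bound[OF E(1,2)]] by auto
  have "2 * lam * (LINT x|M. D x \<bullet> N x) \<le> 0 * (lam * (LINT x|M. (norm (N x))\<^sup>2)) + (LINT x|M. K 0 x)"
  proof (rule LIMSEQ_le_const)
    show "(\<lambda>n. E n * (lam * (LINT x|M. (norm (N x))\<^sup>2)) + (LINT x|M. K (E n) x)) \<longlonglongrightarrow>
        0 * (lam * (LINT x|M. (norm (N x))\<^sup>2)) + (LINT x|M. K 0 x)"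
      by (intro tendsto_intros E0 conv)
  qed (use step E in blast)
  moreover have "K 0 = (\<lambda>x. max (p (det (D x))) 0 * - (cof (D x) \<bullet> P x) + max (- p (det (D x))) 0 * (2 * \<zeta> x * det (D x)))"
    by (simp add: K_def e t_def fun_eq_iff)
  ultimately show "integrable M (\<lambda>x. max (p (det (D x))) 0 * - (cof (D x) \<bullet> P x) + max (- p (det (D x))) 0 * (2 * \<zeta> x * det (D x)))"
    and "2 * lam * (LINT x|M. D x \<bullet> (\<zeta> x *\<^sub>R D x + P x)) \<le>
      (LINT x|M. max (p (det (D x))) 0 * - (cof (D x) \<bullet> P x) + max (- p (det (D x))) 0 * (2 * \<zeta> x * det (D x)))"
    using K0_int by (auto simp: N_def)
qed

section \<open>The radial cutoff and the rank-one field it produces\<close>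

text \<open>The values of \<open>f\<close> at negative arguments are uncontrolled, so they are
  overwritten by \<open>c\<close>. The new function agrees with \<open>f\<close> on
  \<open>{0<..}\<close> and is constant on \<open>{..<r}\<close>; these two open sets cover the
  line.\<close>

lemma smooth_on_extend_const:
  fixes f :: "real \<Rightarrow> real"
  assumes "smooth_on {0..} f" "r > 0" "\<And>R. 0 \<le> R \<Longrightarrow> R \<le> r \<Longrightarrow> f R = c"
  shows "smooth_on UNIV (\<lambda>s. if s \<le> 0 then c else f s)" (is "smooth_on UNIV ?F")
  unfolding smooth_on_def
proof
  fix k
  have "C_k_on k {0<..} f"
    by (rule C_k_on_open_subset[of k "{0..}"]) (use assms(1) in \<open>auto simp: smooth_on_def\<close>)
  then have "C_k_on k {0<..} ?F"
    by (rule C_k_on_cong[OF open_greaterThan, THEN iffD1, rotated]) auto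
  moreover have "C_k_on k {..<r} ?F"
    by (rule C_k_on_cong[THEN iffD1, OF _ _ C_k_on_const[of _ _ c]]) (auto simp: assms(3))
  moreover have "{0<..} \<union> {..<r} = UNIV"
    using assms(2) by auto
  ultimately show "C_k_on k UNIV ?F"
    using C_k_on_Un[OF open_greaterThan open_lessThan] by metis
qed

text \<open>Rescaling by r turns the plateau of \<open>f\<close> up to r into the value 0 up to 1,
  and the vanishing of \<open>f\<close> from 2r on into the value 1 from 2 on.\<close>

lemma smooth_step_of_cutoff:
  fixes f :: "real \<Rightarrow> real"
  assumes f: "smooth_on {0..} f" and r: "r > 0" and one: "\<And>R. 0 \<le> R \<Longrightarrow> R \<le> r \<Longrightarrow> f R = 1"
    and zero: "\<And>R. R \<ge> 2 * r \<Longrightarrow> f R = 0" and range: "f ` {0..} \<subseteq> {0..1}"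
  shows "smooth_step (\<lambda>y. 1 - (if r * y \<le> 0 then 1 else f (r * y)))"
proof -
  let ?F = "\<lambda>s. if s \<le> 0 then 1 else f s"
  have "smooth_on UNIV (\<lambda>y. ?F (r * y))"
    using smooth_on_affine_comp[OF smooth_on_extend_const[OF f r one] bounded_linear_mult_right, of r 0]
    by (simp only: add_0_right)
  then have "C_k_on k UNIV (\<lambda>y. 1 + (- 1) * ?F (r * y))" for k
    by (intro C_k_on_add C_k_on_mult C_k_on_const) (simp_all add: smooth_on_def)
  then have "smooth_on UNIV (\<lambda>y. 1 - ?F (r * y))"
    by (simp add: smooth_on_def)
  moreover have "1 - ?F s \<in> {0..1}" for s
    using range by (cases "s \<le> 0") (auto simp: image_subset_iff)
  moreover have "1 - ?F (r * y) = 0" if "y \<le> 1" for y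
    using one[of "r * y"] r that by (auto simp: mult_left_le)
  moreover have "1 - ?F (r * y) = 1" if "y \<ge> 2" for y
  proof -
    have "2 * r \<le> r * y" using r that by (simp add: mult.commute)
    then have "\<not> r * y \<le> 0" using r by linarith
    then show ?thesis using zero[OF \<open>2 * r \<le> r * y\<close>] by simp
  qed
  ultimately show ?thesis
    unfolding smooth_step_def by blast
qed

lemma smooth_on_radial_cutoff_square:
  fixes f :: "real \<Rightarrow> real" and a :: "'a::euclidean_space"
  assumes f: "smooth_on {0..} f" and r: "r > 0" and one: "\<And>R. 0 \<le> R \<Longrightarrow> R \<le> r \<Longrightarrow> f R = 1"
  shows "smooth_on UNIV (\<lambda>x. (f (norm (x - a)))\<^sup>2)"
proof (rule smooth_on_radial[where g = "\<lambda>s. (f s)\<^sup>2" and c = 1])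
  have "smooth_on {0<..} f"
    using f by (rule smooth_on_open_subset) auto
  then show "smooth_on {0<..} (\<lambda>s. (f s)\<^sup>2)"
    unfolding power2_eq_square by (intro smooth_on_mult) auto
qed (use r one in auto)

lemma gradient_radial_cutoff_square:
  fixes f :: "real \<Rightarrow> real" and a x :: "real^2"
  assumes f: "smooth_on {0..} f" and r: "r > 0" and one: "\<And>R. 0 \<le> R \<Longrightarrow> R \<le> r \<Longrightarrow> f R = 1"
  shows "gradient (\<lambda>y. (f (norm (y - a)))\<^sup>2) x =
    (2 * f (norm (x - a)) * deriv f (norm (x - a))) *\<^sub>R ((x - a) /\<^sub>R norm (x - a))"
proof (cases "x = a")
  \<comment> \<open>At the centre the function is locally constant, and on the right-hand side the
    vector \<open>(x - a) /\<^sub>R norm (x - a)\<close> is 0.\<close>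
  case True
  have "((\<lambda>y. (f (norm (y - a)))\<^sup>2) has_derivative (\<lambda>v. 0)) (at x)"
  proof (rule has_derivative_transform_within_open[of "\<lambda>x. 1"])
    show "1 = (f (norm (y - a)))\<^sup>2" if "y \<in> ball a r" for y
      using that one[of "norm (y - a)"] by (simp add: dist_norm norm_minus_commute)
  qed (use True r in auto)
  then have "frechet_derivative (\<lambda>y. (f (norm (y - a)))\<^sup>2) (at x) = (\<lambda>v. 0)"
    by (metis frechet_derivative_at)
  then have "gradient (\<lambda>y. (f (norm (y - a)))\<^sup>2) x = 0"
    unfolding gradient_def by (simp add: vec_eq_iff)
  with True show ?thesis by simp
next
  case False
  let ?R = "norm (x - a)"
  have R: "?R > 0" using False by simp
  have "smooth_on {0<..} f"
    using f by (rule smooth_on_open_subset) auto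
  then have "C_k_on (Suc 0) {0<..} f"
    by (simp add: smooth_on_def del: C_k_on.simps)
  then have "f differentiable (at ?R)"
    unfolding differentiable_def using C_k_on_SucD(1)[OF open_greaterThan, of 0 0 f ?R] R by auto
  then have fD: "(f has_real_derivative deriv f ?R) (at ?R)"
    by (metis DERIV_imp_deriv real_differentiable_def)
  have "((\<lambda>s. (f s)\<^sup>2) has_real_derivative (2 * f ?R * deriv f ?R)) (at ?R)"
    using DERIV_power[OF fD, of 2] by (simp add: mult_ac)
  then have D2: "((\<lambda>s. (f s)\<^sup>2) has_derivative (\<lambda>h. 2 * f ?R * deriv f ?R * h)) (at ?R)"
    by (simp add: has_field_derivative_def)
  have sub: "((\<lambda>y. y - a) has_derivative (\<lambda>h. h)) (at x)"
    by (auto intro!: derivative_eq_intros)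
  have "((\<lambda>y. norm (y - a)) has_derivative (\<lambda>h. h \<bullet> sgn (x - a))) (at x)"
    using has_derivative_compose[OF sub has_derivative_norm[of "x - a"]] False by simp
  from has_derivative_compose[OF this D2]
  have "((\<lambda>y. (f (norm (y - a)))\<^sup>2) has_derivative (\<lambda>h. 2 * f ?R * deriv f ?R * (h \<bullet> sgn (x - a)))) (at x)" .
  from frechet_derivative_at[OF this, symmetric] show ?thesis
    by (simp add: gradient_def vec_eq_iff sgn_div_norm inner_axis')
qed

text \<open>The bridge from the determinant expansion to the twist: with \<open>p = u x - a\<close>
  and \<open>q\<close> the radial direction the right-hand side is the twist.\<close>

lemma cof_inner_tensor: "cof A \<bullet> (p \<otimes>\<^sub>v q) = (adj A *v p) \<bullet> q"
  by (simp add: cof_def adj_def tensor_def transpose_def matrix_vector_mult_def inner_vec_def sum_2 algebra_simps)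

lemma det_tensor: "det (p \<otimes>\<^sub>v q) = 0"
  by (simp add: det_2 tensor_def)

lemma continuous_on_tensor:
  "continuous_on S p \<Longrightarrow> continuous_on S q \<Longrightarrow> continuous_on S (\<lambda>x. p x \<otimes>\<^sub>v q x)"
  unfolding tensor_def by (intro continuous_on_vec_lambda continuous_intros)

section \<open>The competitor and its energy\<close>

text \<open>\<open>u\<close> is merely continuous in the open set \<Omega> and may be unbounded near
  its boundary. Everything is confined to the compact \<open>K\<close> inside \<Omega>, where
  \<open>u\<close> is bounded, and extended by zero.\<close>

lemma cutoff_displacement:
  assumes \<Omega>: "open \<Omega>" "bounded \<Omega>" and K: "compact K" "K \<subseteq> \<Omega>" and u: "continuous_on \<Omega> u"
    and \<zeta>: "smooth_on UNIV \<zeta>" "\<And>x. \<bar>\<zeta> x\<bar> \<le> 1" "\<And>x. x \<notin> K \<Longrightarrow> \<zeta> x = 0"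
    and A: "is_weak_gradient \<Omega> u A" "L2_on \<Omega> A"
  shows "continuous_on UNIV (\<lambda>x. \<zeta> x *\<^sub>R (u x - a))"
    and "\<exists>B. \<forall>x. norm (\<zeta> x *\<^sub>R (u x - a)) \<le> B"
    and "(\<lambda>x. \<zeta> x *\<^sub>R (u x - a)) \<in> W12 \<Omega>"
    and "L2_on \<Omega> (\<lambda>x. (u x - a) \<otimes>\<^sub>v gradient \<zeta> x)"
proof -
  let ?w = "\<lambda>x. \<zeta> x *\<^sub>R (u x - a)" and ?P = "\<lambda>x. (u x - a) \<otimes>\<^sub>v gradient \<zeta> x"
  have \<Omega>_sets: "\<Omega> \<in> sets lebesgue" using \<Omega> by auto
  have \<zeta>_cont: "continuous_on UNIV \<zeta>"
    using \<zeta>(1) by (rule smooth_on_imp_continuous_on)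
  have w\<Omega>: "continuous_on \<Omega> ?w"
    by (intro continuous_intros u continuous_on_subset[OF \<zeta>_cont]) auto
  have "continuous_on (- K) ?w"
    by (rule continuous_on_eq[of _ "\<lambda>x. 0"]) (auto simp: \<zeta>(3))
  then have "continuous_on (\<Omega> \<union> - K) ?w"
    using w\<Omega> \<Omega>(1) K(1) by (intro continuous_on_open_Un) (auto simp: compact_imp_closed)
  moreover have "\<Omega> \<union> - K = UNIV" using K(2) by auto
  ultimately show cont: "continuous_on UNIV ?w" by simp
  \<comment> \<open>Polymorphic in the codomain because it serves both the displacement and the
    matrix field \<open>?P\<close>.\<close>
  have bdd: "\<exists>B. \<forall>x. norm (q x) \<le> B" if "continuous_on \<Omega> q" "\<And>x. x \<notin> K \<Longrightarrow> q x = 0"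
    for q :: "real^2 \<Rightarrow> 'c::real_normed_vector"
  proof -
    have "bounded (q ` K)"
      using K that(1) by (intro compact_imp_bounded compact_continuous_image) (auto intro: continuous_on_subset)
    then obtain B where "\<And>x. x \<in> K \<Longrightarrow> norm (q x) \<le> B"
      by (auto simp: bounded_iff)
    then have "norm (q x) \<le> max B 0" for x
      using that(2)[of x] by (cases "x \<in> K") (auto simp: le_max_iff_disj)
    then show ?thesis by blast
  qed
  show wB: "\<exists>B. \<forall>x. norm (?w x) \<le> B"
    by (rule bdd[OF w\<Omega>]) (simp add: \<zeta>(3))
  have "continuous_on \<Omega> (gradient \<zeta>)"
    using continuous_on_vec_lambda[of \<Omega> "\<lambda>j x. gradient \<zeta> x $ j"]
      continuous_on_subset[OF continuous_on_gradient[OF \<zeta>(1)] subset_UNIV] by simp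
  then have P\<Omega>: "continuous_on \<Omega> ?P"
    by (intro continuous_on_tensor continuous_intros u)
  have "closure {x. \<zeta> x \<noteq> 0} \<subseteq> K"
    using \<zeta>(3) K(1) by (intro closure_minimal) (auto simp: compact_imp_closed)
  then have "gradient \<zeta> x = 0" if "x \<notin> K" for x
    using gradient_zero_outside_support[of x \<zeta>] that by blast
  then have "?P x = 0" if "x \<notin> K" for x
    using that by (simp add: tensor_def vec_eq_iff)
  with bdd[OF P\<Omega>] obtain B where "\<And>x. norm (?P x) \<le> B" by blast
  then show L2P: "L2_on \<Omega> ?P"
    using \<Omega>(2) \<Omega>_sets by (intro L2_on_bounded continuous_imp_measurable_on_sets_lebesgue P\<Omega>) auto
  have "L2_on \<Omega> (\<lambda>x. \<zeta> x *\<^sub>R A x)"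
    by (rule L2_on_scaleR_bounded[OF A(2)])
       (auto intro: \<zeta>(2) continuous_imp_measurable_on_sets_lebesgue continuous_on_subset[OF \<zeta>_cont] \<Omega>_sets)
  then have "L2_on \<Omega> (\<lambda>x. \<zeta> x *\<^sub>R A x + ?P x)"
    using L2P by (rule L2_on_add)
  moreover obtain B' where "\<And>x. norm (?w x) \<le> B'" using wB by blast
  then have "L2_on \<Omega> ?w"
    using \<Omega>(2) \<Omega>_sets by (intro L2_on_bounded continuous_imp_measurable_on_sets_lebesgue w\<Omega>) auto
  ultimately show "?w \<in> W12 \<Omega>"
    using weak_gradient_cutoff[OF \<Omega>(1) A(1) \<zeta>(1)] by (auto simp: W12_def)
qed

lemma gradient_const: "gradient (\<lambda>x. c) x = 0"
  by (simp add: gradient_def vec_eq_iff)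

lemma weak_gradient_scaleR:
  assumes "open \<Omega>" "is_weak_gradient \<Omega> w A"
  shows "is_weak_gradient \<Omega> (\<lambda>x. c *\<^sub>R w x) (\<lambda>x. c *\<^sub>R A x)"
proof -
  have "smooth_on UNIV (\<lambda>x::real^2. c)"
    by (simp add: smooth_on_def C_k_on_const)
  moreover have "p \<otimes>\<^sub>v 0 = 0" for p
    by (simp add: tensor_def vec_eq_iff)
  ultimately show ?thesis
    using weak_gradient_mult[OF assms, of "\<lambda>x. c"] by (simp add: gradient_const)
qed

lemma L2_on_const_scaleR: "L2_on \<Omega> f \<Longrightarrow> L2_on \<Omega> (\<lambda>x. c *\<^sub>R f x)"
  by (rule L2_on_scaleR_bounded[of _ _ "\<lambda>x. c" "\<bar>c\<bar>"]) auto

lemma W12_scaleR: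
  assumes "open \<Omega>" "w \<in> W12 \<Omega>"
  shows "(\<lambda>x. c *\<^sub>R w x) \<in> W12 \<Omega>"
proof -
  obtain A where "is_weak_gradient \<Omega> w A" "L2_on \<Omega> A"
    using assms(2) by (auto simp: W12_def)
  then have "is_weak_gradient \<Omega> (\<lambda>x. c *\<^sub>R w x) (\<lambda>x. c *\<^sub>R A x)" "L2_on \<Omega> (\<lambda>x. c *\<^sub>R A x)"
    by (auto intro: weak_gradient_scaleR[OF assms(1)] L2_on_const_scaleR)
  moreover have "L2_on \<Omega> (\<lambda>x. c *\<^sub>R w x)"
    using assms(2) by (auto simp: W12_def intro: L2_on_const_scaleR)
  ultimately show ?thesis by (auto simp: W12_def)
qed

text \<open>Exchanges the arbitrary representative \<open>wgrad\<close> for an explicit gradient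
  \<open>B\<close>, and the extended-valued h for a real function, which is legitimate because h is
  finite at positive determinants.\<close>

lemma energy_eq_nn_integral:
  assumes "smooth_step G" "open \<Omega>" "is_weak_gradient \<Omega> v B" "lam \<ge> 0"
    and "AE x in lebesgue_on \<Omega>. det (B x) > 0" "\<And>s. s > 0 \<Longrightarrow> h s < \<infinity>"
  shows "energy lam h \<Omega> v =
    (\<integral>\<^sup>+x. ennreal (lam * (norm (B x))\<^sup>2 + enn2real (h (det (B x)))) \<partial>lebesgue_on \<Omega>)"
  unfolding energy_def
proof (rule nn_integral_cong_AE)
  show "AE x in lebesgue_on \<Omega>. ennreal (lam * (norm (wgrad \<Omega> v x))\<^sup>2) + h (det (wgrad \<Omega> v x)) =
      ennreal (lam * (norm (B x))\<^sup>2 + enn2real (h (det (B x))))"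
    using wgrad_AE_eq[OF assms(1-3)] assms(5)
  proof eventually_elim
    case (elim x)
    have "h (det (B x)) = ennreal (enn2real (h (det (B x))))"
      using assms(6)[OF elim(2)] by (simp add: less_top)
    then show ?case
      using elim assms(4) ennreal_plus[of "lam * (norm (B x))\<^sup>2" "enn2real (h (det (B x)))"] by simp
  qed
qed

text \<open>A ball is connected: if it met both \<open>S\<close> and its complement it would contain
  a frontier point, and that point would be too close to \<open>T\<close>.\<close>

lemma cball_subset_of_setdist_frontier:
  fixes S :: "'a::euclidean_space set"
  assumes "x \<in> T" "T \<subseteq> S" "\<rho> < setdist T (frontier S)"
  shows "cball x \<rho> \<subseteq> S"
proof (rule ccontr)
  assume "\<not> cball x \<rho> \<subseteq> S"
  then have "\<rho> \<ge> 0" by (metis cball_empty empty_subsetI not_le)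
  then have "x \<in> cball x \<rho> \<inter> S" using assms by auto
  then obtain y where "y \<in> cball x \<rho>" "y \<in> frontier S"
    using connected_Int_frontier[of "cball x \<rho>" S] \<open>\<not> cball x \<rho> \<subseteq> S\<close> connected_cball by blast
  then show False
    using setdist_le_dist[OF assms(1), of y "frontier S"] assms(3) by auto
qed

lemma h_fun_borel_measurable:
  assumes "h_data \<theta> c\<^sub>1 c\<^sub>2 l m" and h: "h = h_fun \<theta> c\<^sub>1 c\<^sub>2 l m"
  shows "(\<lambda>s. enn2real (h s)) \<in> borel_measurable borel" "h_deriv h \<in> borel_measurable borel"
proof -
  have cont: "continuous_on {0<..} (\<lambda>s. enn2real (h s))"
    using h_fun_derivative(1)[OF assms] by (auto intro!: continuous_at_imp_continuous_on DERIV_isCont)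
  \<comment> \<open>\<open>enn2real\<close> sends \<infinity> to 0, so the real version of h
    vanishes for s \<le> 0, and so does its derivative for s < 0. The derivative at 0 is left
    unevaluated as a single exceptional value.\<close>
  have "(\<lambda>s. enn2real (h s)) = (\<lambda>s. if s \<in> {0<..} then enn2real (h s) else 0)"
    by (auto simp: h h_fun_def fun_eq_iff)
  also have "\<dots> \<in> borel_measurable borel"
    by (intro borel_measurable_continuous_on_if cont) auto
  finally show "(\<lambda>s. enn2real (h s)) \<in> borel_measurable borel" .
  have neg: "h_deriv h s = 0" if "s < 0" for s
  proof -
    have "((\<lambda>s. enn2real (h s)) has_real_derivative 0) (at s)"
      by (rule has_field_derivative_transform_within_open[of "\<lambda>s. 0" _ _ "{..<0}"])
         (use that in \<open>auto simp: h h_fun_def\<close>)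
    then show ?thesis by (simp add: h_deriv_def DERIV_imp_deriv)
  qed
  have "h_deriv h = (\<lambda>s. if s = 0 then h_deriv h 0 else if s \<in> {0<..} then h_deriv h s else 0)"
    using neg by (auto simp: fun_eq_iff)
  also have "\<dots> \<in> borel_measurable borel"
    by (intro measurable_If borel_measurable_continuous_on_if h_fun_derivative(3)[OF assms]) auto
  finally show "h_deriv h \<in> borel_measurable borel" .
qed

section \<open>The inequality for strong local minimizers\<close>

theorem lemma3p5:
  fixes \<Omega> :: "(real^2) set" and u\<^sub>0 u :: "real^2 \<Rightarrow> real^2"
    and lam l m c\<^sub>1 c\<^sub>2 :: real and \<theta> :: "real \<Rightarrow> real" and h :: "real \<Rightarrow> ennreal"
    and z x\<^sub>0 :: "real^2" and \<delta> r r' c :: real and f :: "real \<Rightarrow> real"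
  assumes "bounded_domain \<Omega>" and "lipschitz_boundary \<Omega>"
    and "\<exists>w. homeomorphism (closure \<Omega>) (u\<^sub>0 ` closure \<Omega>) u\<^sub>0 w"
    and "admissible1 \<Omega> u\<^sub>0 \<noteq> {}"
    and "lam > 0" and "h_data \<theta> c\<^sub>1 c\<^sub>2 l m" and "h = h_fun \<theta> c\<^sub>1 c\<^sub>2 l m"
    and "strong_local_minimizer lam h \<Omega> u\<^sub>0 u"
    and "ball z \<delta> \<subset>\<subset> \<Omega>" and "0 < r'" and "r' < setdist (ball z \<delta>) (frontier \<Omega>)"
    and "F_fun \<Omega> u (ball z \<delta>) r' = 0"
    and "x\<^sub>0 \<in> ball z \<delta>"
    and "AE x in lebesgue_on (ball x\<^sub>0 r'). twist \<Omega> x x\<^sub>0 u \<ge> 0"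
    and "0 < 2 * r" and "2 * r < r'"
    and "f ` {0..} \<subseteq> {0..1}" and "smooth_on {0..} f"
    and "\<And>R. 0 \<le> R \<Longrightarrow> R \<le> r \<Longrightarrow> f R = 1"
    and "\<And>R. R \<ge> 2 * r \<Longrightarrow> f R = 0"
    and "\<And>R. r < R \<Longrightarrow> R < 2 * r \<Longrightarrow> \<bar>deriv f R\<bar> \<le> c / r"
    and "\<And>R. R > 0 \<Longrightarrow> deriv f R \<le> 0"
  shows
    "let R = (\<lambda>x. norm (x - x\<^sub>0));
         \<eta> = (\<lambda>x. f (R x));
         a = u x\<^sub>0;
         t = (\<lambda>x. twist \<Omega> x x\<^sub>0 u);
         Du = wgrad \<Omega> u;
         d = (\<lambda>x. det (Du x))
     in lam * (LINT x|lebesgue_on \<Omega>.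
            (\<eta> x)\<^sup>2 * (norm (Du x))\<^sup>2 + Du x \<bullet> ((u x - a) \<otimes>\<^sub>v gradient (\<lambda>y. (\<eta> y)\<^sup>2) x))
        \<le> (LINT x|lebesgue_on {x \<in> \<Omega>. d x < 1}. (\<eta> x)\<^sup>2 * \<bar>h_deriv h (d x)\<bar> * d x)
          + (LINT x|lebesgue_on {x \<in> \<Omega>. d x \<ge> 1}.
               \<eta> x * t x * h_deriv h (d x) * \<bar>deriv f (R x)\<bar>)"
proof -
  define D where "D = wgrad \<Omega> u"
  define a where "a = u x\<^sub>0"
  define \<zeta> where "\<zeta> = (\<lambda>x. (f (norm (x - x\<^sub>0)))\<^sup>2)"
  define w where "w = (\<lambda>x. \<zeta> x *\<^sub>R (u x - a))"
  define P where "P = (\<lambda>x. (u x - a) \<otimes>\<^sub>v gradient \<zeta> x)"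
  define M where "M = lebesgue_on \<Omega>"
  define H where "H = (\<lambda>s. enn2real (h s))"
  define p where "p = h_deriv h"
  define K where "K = cball x\<^sub>0 (2 * r)"
  have \<Omega>: "open \<Omega>" "bounded \<Omega>"
    using assms(1) by (auto simp: bounded_domain_def)
  then have \<Omega>_sets: "\<Omega> \<in> sets lebesgue" by auto
  have r: "r > 0" using assms(15) by simp
  note one = assms(19) and zero = assms(20)
  have f01: "0 \<le> f R" "f R \<le> 1" if "R \<ge> 0" for R
    using assms(17) that by (auto simp: image_subset_iff)
  obtain G :: "real \<Rightarrow> real" where G: "smooth_step G"
    using smooth_step_of_cutoff[OF assms(18) r one zero assms(17)] by blast
  have K: "compact K" "K \<subseteq> \<Omega>"
  proof -
    have "ball z \<delta> \<subseteq> \<Omega>"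
      using assms(9) closure_subset by (auto simp: compactly_contained_def)
    then show "K \<subseteq> \<Omega>"
      unfolding K_def using assms(11,16) by (intro cball_subset_of_setdist_frontier[OF assms(13)]) auto
  qed (simp add: K_def)
  have \<zeta>: "smooth_on UNIV \<zeta>" "\<And>x. 0 \<le> \<zeta> x" "\<And>x. \<zeta> x \<le> 1" "\<And>x. x \<notin> K \<Longrightarrow> \<zeta> x = 0"
  proof -
    show "smooth_on UNIV \<zeta>"
      unfolding \<zeta>_def by (rule smooth_on_radial_cutoff_square[OF assms(18) r one])
    show "0 \<le> \<zeta> x" "\<zeta> x \<le> 1" for x
      using f01[of "norm (x - x\<^sub>0)"] by (auto simp: \<zeta>_def power_le_one)
    show "\<zeta> x = 0" if "x \<notin> K" for x
      using that zero[of "norm (x - x\<^sub>0)"] by (simp add: \<zeta>_def K_def dist_norm norm_minus_commute)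
  qed
  have u: "u \<in> admissible lam h \<Omega> u\<^sub>0"
    using assms(8) by (simp add: strong_local_minimizer_def)
  then have u1: "u \<in> W12 \<Omega>" "continuous_on \<Omega> u" "AE x in M. det (D x) > 0" "has_trace \<Omega> u u\<^sub>0"
    "energy lam h \<Omega> u < \<infinity>"
    unfolding admissible_def admissible1_def D_def M_def by blast+
  obtain \<gamma> where \<gamma>: "\<gamma> > 0" "\<And>v. v \<in> admissible lam h \<Omega> u\<^sub>0 \<Longrightarrow>
      Linf_norm \<Omega> (\<lambda>x. v x - u x) < ereal \<gamma> \<Longrightarrow> energy lam h \<Omega> u \<le> energy lam h \<Omega> v"
    using assms(8) by (auto simp: strong_local_minimizer_def)
  have D: "is_weak_gradient \<Omega> u D" "L2_on \<Omega> D"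
    unfolding D_def by (rule wgrad_L2[OF G \<Omega>(1) u1(1)])+
  have Dm[measurable]: "D \<in> borel_measurable M" and D2: "integrable M (\<lambda>x. (norm (D x))\<^sup>2)"
    using D(2) by (auto simp: L2_on_def M_def)
  have \<zeta>_abs: "\<bar>\<zeta> x\<bar> \<le> 1" for x using \<zeta>(2,3)[of x] by simp
  have cd: "continuous_on UNIV w" "\<exists>B. \<forall>x. norm (w x) \<le> B" "w \<in> W12 \<Omega>" "L2_on \<Omega> P"
    unfolding w_def P_def by (rule cutoff_displacement[OF \<Omega> K u1(2) \<zeta>(1) \<zeta>_abs _ D], erule \<zeta>(4))+
  have Pm[measurable]: "P \<in> borel_measurable M" and P2: "integrable M (\<lambda>x. (norm (P x))\<^sup>2)"
    using cd(4) by (auto simp: L2_on_def M_def)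
  have \<zeta>m[measurable]: "\<zeta> \<in> borel_measurable M"
    unfolding M_def by (rule continuous_imp_measurable_on_sets_lebesgue)
      (auto intro: continuous_on_subset[OF smooth_on_imp_continuous_on[OF \<zeta>(1)]] \<Omega>_sets)
  have \<zeta>_int: "integrable M \<zeta>"
    unfolding M_def using \<zeta>m \<zeta>(2,3)
    by (intro finite_measure.integrable_const_bound[OF lebesgue_on_finite_measure[OF \<Omega>(2) \<Omega>_sets], where B = 1])
       (auto simp: M_def)
  have h_fin: "h s < \<infinity>" if "s > 0" for s
    using that by (simp add: assms(7) h_fun_def)
  note hd = h_fun_derivative[OF assms(6,7), folded H_def p_def]
  have Hm[measurable]: "H \<in> borel_measurable borel" and pm[measurable]: "p \<in> borel_measurable borel"
    unfolding H_def p_def by (rule h_fun_borel_measurable[OF assms(6,7)])+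
  have H_nonneg: "H s \<ge> 0" for s by (simp add: H_def)
  have dm[measurable]: "(\<lambda>x. det (D x)) \<in> borel_measurable M"
    by (rule det_borel_measurable[OF Dm])
  have lam: "lam > 0" by (rule assms(5))
  have energy_u: "energy lam h \<Omega> u = (\<integral>\<^sup>+x. ennreal (lam * (norm (D x))\<^sup>2 + H (det (D x))) \<partial>M)"
    unfolding M_def H_def using lam
    by (intro energy_eq_nn_integral[OF G \<Omega>(1) D(1) _ u1(3)[unfolded M_def]] h_fin) auto
  have EI: "integrable M (\<lambda>x. lam * (norm (D x))\<^sup>2 + H (det (D x)))"
    using u1(5) lam H_nonneg unfolding energy_u by (intro integrableI_nonneg) auto
  \<comment> \<open>Finite energy bounds the sum of both densities; the gradient part is integrable
    by itself and can be subtracted.\<close>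
  have HI: "integrable M (\<lambda>x. H (det (D x)))"
    using Bochner_Integration.integrable_diff[OF EI integrable_mult_right[OF D2, of lam]] by simp

  \<comment> \<open>The factor 2 comes from differentiating the square of the cutoff, and the minus
    sign is absorbed by \<open>deriv f \<le> 0\<close>. At \<open>x = x\<^sub>0\<close> both sides
    are 0 because \<open>u x - a\<close> and \<open>x - x\<^sub>0\<close> vanish.\<close>
  have twist_eq: "- (cof (D x) \<bullet> P x) = 2 * f (norm (x - x\<^sub>0)) * twist \<Omega> x x\<^sub>0 u * \<bar>deriv f (norm (x - x\<^sub>0))\<bar>" for x
  proof (cases "x = x\<^sub>0")
    case True
    have "P x = 0"
      unfolding P_def a_def True by (simp add: tensor_def vec_eq_iff)
    then show ?thesis using True by (simp add: twist_def)
  next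
    case False
    then have "deriv f (norm (x - x\<^sub>0)) \<le> 0"
      using assms(22)[of "norm (x - x\<^sub>0)"] by simp
    then have abs: "\<bar>deriv f (norm (x - x\<^sub>0))\<bar> = - deriv f (norm (x - x\<^sub>0))" by simp
    have "gradient \<zeta> x = (2 * f (norm (x - x\<^sub>0)) * deriv f (norm (x - x\<^sub>0))) *\<^sub>R ((x - x\<^sub>0) /\<^sub>R norm (x - x\<^sub>0))"
      unfolding \<zeta>_def by (rule gradient_radial_cutoff_square[OF assms(18) r one])
    then show ?thesis
      unfolding P_def cof_inner_tensor abs
      by (simp add: twist_def D_def a_def)
  qed
  \<comment> \<open>The sign of the twist is known in the ball of radius \<open>r'\<close> only;
    outside it the cutoff vanishes because \<open>2 * r < r'\<close>.\<close>
  have \<tau>: "AE x in M. - (cof (D x) \<bullet> P x) \<ge> 0"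
  proof -
    have "AE x in lebesgue. x \<in> ball x\<^sub>0 r' \<longrightarrow> twist \<Omega> x x\<^sub>0 u \<ge> 0"
      using assms(14) by (simp add: AE_restrict_space_iff)
    then have "AE x in lebesgue. - (cof (D x) \<bullet> P x) \<ge> 0"
    proof eventually_elim
      case (elim x)
      show ?case
      proof (cases "x \<in> ball x\<^sub>0 r'")
        case True
        then show ?thesis using elim f01(1)[of "norm (x - x\<^sub>0)"] unfolding twist_eq by simp
      next
        case False
        then have "f (norm (x - x\<^sub>0)) = 0"
          using zero[of "norm (x - x\<^sub>0)"] assms(16) by (simp add: dist_norm norm_minus_commute)
        then show ?thesis unfolding twist_eq by simp
      qed
    qed
    then show ?thesis
      using \<Omega>_sets unfolding M_def
      by (subst AE_restrict_space_iff) (auto elim!: eventually_mono)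
  qed

  obtain Bw where Bw: "\<And>x. norm (w x) \<le> Bw" using cd(2) by blast
  have "Bw \<ge> 0" using Bw[of x\<^sub>0] norm_ge_zero[of "w x\<^sub>0"] by linarith
  \<comment> \<open>The displacement is \<epsilon> \<open>w\<close> with \<open>w\<close> bounded by
    \<open>Bw\<close>. The added 1 keeps the denominator positive and makes the distance to
    \<open>u\<close> strictly smaller than \<gamma>.\<close>
  define \<epsilon>\<^sub>0 where "\<epsilon>\<^sub>0 = \<gamma> / (Bw + 1)"
  have \<epsilon>\<^sub>0: "\<epsilon>\<^sub>0 > 0" using \<gamma>(1) \<open>Bw \<ge> 0\<close> by (simp add: \<epsilon>\<^sub>0_def)
  have minimal: "(LINT x|M. lam * (norm (D x))\<^sup>2 + H (det (D x))) \<le>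
      (LINT x|M. lam * (norm (D x - \<epsilon> *\<^sub>R (\<zeta> x *\<^sub>R D x + P x)))\<^sup>2 + H (det (D x - \<epsilon> *\<^sub>R (\<zeta> x *\<^sub>R D x + P x))))"
    if \<epsilon>: "0 < \<epsilon>" "\<epsilon> \<le> \<epsilon>\<^sub>0"
      and pos: "AE x in M. det (D x - \<epsilon> *\<^sub>R (\<zeta> x *\<^sub>R D x + P x)) > 0"
      and int: "integrable M (\<lambda>x. lam * (norm (D x - \<epsilon> *\<^sub>R (\<zeta> x *\<^sub>R D x + P x)))\<^sup>2 + H (det (D x - \<epsilon> *\<^sub>R (\<zeta> x *\<^sub>R D x + P x))))"
    for \<epsilon>
  proof -
    define B where "B = (\<lambda>x. D x - \<epsilon> *\<^sub>R (\<zeta> x *\<^sub>R D x + P x))"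
    define v where "v = (\<lambda>x. u x + (- \<epsilon>) *\<^sub>R w x)"
    have "is_weak_gradient \<Omega> w (\<lambda>x. \<zeta> x *\<^sub>R D x + P x)"
      unfolding w_def P_def by (rule weak_gradient_cutoff[OF \<Omega>(1) D(1) \<zeta>(1)])
    then have vB: "is_weak_gradient \<Omega> v B"
      using weak_gradient_add[OF \<Omega>(1) D(1) weak_gradient_scaleR[OF \<Omega>(1), of w _ "- \<epsilon>"]]
      by (simp add: v_def B_def)
    have posB: "AE x in lebesgue_on \<Omega>. det (B x) > 0"
      using pos unfolding M_def B_def .
    have energy_v: "energy lam h \<Omega> v = (\<integral>\<^sup>+x. ennreal (lam * (norm (B x))\<^sup>2 + H (det (B x))) \<partial>M)"
      unfolding M_def H_def using lam
      by (intro energy_eq_nn_integral[OF G \<Omega>(1) vB _ posB] h_fin) auto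
    also have "\<dots> = ennreal (LINT x|M. lam * (norm (B x))\<^sup>2 + H (det (B x)))"
      using int lam H_nonneg by (intro nn_integral_eq_integral) (auto simp: B_def)
    finally have energy_v: "energy lam h \<Omega> v = ennreal (LINT x|M. lam * (norm (B x))\<^sup>2 + H (det (B x)))" .
    have "v \<in> admissible lam h \<Omega> u\<^sub>0"
      unfolding admissible_def admissible1_def
    proof (intro CollectI conjI)
      have w12: "(\<lambda>x. (- \<epsilon>) *\<^sub>R w x) \<in> W12 \<Omega>"
        by (rule W12_scaleR[OF \<Omega>(1) cd(3)])
      show "v \<in> W12 \<Omega>"
        unfolding v_def by (rule W12_add[OF \<Omega>(1) u1(1) w12])
      have w_cont: "continuous_on S (\<lambda>x. (- \<epsilon>) *\<^sub>R w x)" for S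
        by (intro continuous_intros continuous_on_subset[OF cd(1)]) auto
      show "continuous_on \<Omega> v"
        unfolding v_def by (intro continuous_on_add u1(2) w_cont)
      show "AE x in lebesgue_on \<Omega>. 0 < det (wgrad \<Omega> v x)"
        using wgrad_AE_eq[OF G \<Omega>(1) vB] posB by eventually_elim simp
      show "has_trace \<Omega> v u\<^sub>0"
        unfolding v_def
      proof (rule has_trace_add_zero_boundary[OF \<Omega>(1) u1(4) w12 w_cont])
        fix x assume "x \<in> frontier \<Omega>"
        \<comment> \<open>\<Omega> is open and contains \<open>K\<close>, so its frontier does not
          meet \<open>K\<close>.\<close>
        then have "x \<notin> K" using K(2) \<Omega>(1) by (auto simp: frontier_def interior_open)
        then show "(- \<epsilon>) *\<^sub>R w x = 0" by (simp add: w_def \<zeta>(4))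
      qed
      show "energy lam h \<Omega> v < \<infinity>" unfolding energy_v by simp
    qed
    moreover have "Linf_norm \<Omega> (\<lambda>x. v x - u x) < ereal \<gamma>"
    proof -
      have "Linf_norm \<Omega> (\<lambda>x. v x - u x) \<le> ereal (\<epsilon> * Bw)"
        unfolding Linf_norm_def
      proof (rule esssup_I)
        have "(\<lambda>x. norm (v x - u x)) \<in> borel_measurable (lebesgue_on \<Omega>)"
          unfolding v_def using continuous_on_subset[OF cd(1), of \<Omega>]
          by (intro continuous_imp_measurable_on_sets_lebesgue \<Omega>_sets) (auto intro!: continuous_intros)
        then show "(\<lambda>x. ereal (norm (v x - u x))) \<in> borel_measurable (lebesgue_on \<Omega>)"
          by measurable
        show "AE x in lebesgue_on \<Omega>. ereal (norm (v x - u x)) \<le> ereal (\<epsilon> * Bw)"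
          using \<epsilon>(1) Bw by (intro AE_I2) (simp add: v_def mult_left_mono)
      qed
      also have "\<epsilon> * Bw < \<gamma>"
      proof -
        have "\<epsilon> * Bw \<le> \<epsilon>\<^sub>0 * Bw" using \<epsilon>(2) \<open>Bw \<ge> 0\<close> by (rule mult_right_mono)
        also have "\<dots> < \<epsilon>\<^sub>0 * (Bw + 1)" using \<epsilon>\<^sub>0 by simp
        also have "\<dots> = \<gamma>" using \<open>Bw \<ge> 0\<close> by (simp add: \<epsilon>\<^sub>0_def)
        finally show ?thesis .
      qed
      finally show ?thesis by simp
    qed
    ultimately have "energy lam h \<Omega> u \<le> energy lam h \<Omega> v"
      by (rule \<gamma>(2))
    also have "energy lam h \<Omega> u = ennreal (LINT x|M. lam * (norm (D x))\<^sup>2 + H (det (D x)))"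
      unfolding energy_u using EI lam H_nonneg by (intro nn_integral_eq_integral) auto
    finally show ?thesis
      unfolding energy_v B_def using lam H_nonneg by (simp add: integral_nonneg_AE)
  qed

  define Q where "Q = (\<lambda>x. max (p (det (D x))) 0 * - (cof (D x) \<bullet> P x) + max (- p (det (D x))) 0 * (2 * \<zeta> x * det (D x)))"
  have l: "l \<ge> 0" and c1: "1 / c\<^sub>1 \<ge> 0"
    using assms(6) by (auto simp: h_data_def)
  \<comment> \<open>The instance is \<open>C = 1 / c\<^sub>1\<close>. The premise skipped by the
    underscore is \<open>det (P x) = 0\<close>, discharged afterwards because \<open>P\<close> is a
    tensor product.\<close>
  note var = first_variation_inequality[OF hd(1,2) l hd(5) c1 hd(6) hd(3) H_nonneg Hm pm Dm Pm D2 P2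
      \<zeta>m \<zeta>(2,3) \<zeta>_int u1(3) \<tau> _ HI \<epsilon>\<^sub>0 minimal, folded Q_def]
  have Q_int: "integrable M Q" and Q_le: "2 * lam * (LINT x|M. D x \<bullet> (\<zeta> x *\<^sub>R D x + P x)) \<le> (LINT x|M. Q x)"
    by (rule var; simp add: P_def det_tensor)+

  define S\<^sub>1 where "S\<^sub>1 = {x \<in> \<Omega>. det (D x) < 1}"
  define S\<^sub>2 where "S\<^sub>2 = {x \<in> \<Omega>. det (D x) \<ge> 1}"
  have space_M: "space M = \<Omega>" by (simp add: M_def)
  have S_M: "S\<^sub>1 \<in> sets M" "S\<^sub>2 \<in> sets M"
    unfolding S\<^sub>1_def S\<^sub>2_def space_M[symmetric] by measurable
  \<comment> \<open>The claim integrates over subsets with their own restricted measure; this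
    identifies them with restrictions of \<open>M\<close>, where the integrability of
    \<open>Q\<close> is known.\<close>
  have restr: "lebesgue_on S = restrict_space M S" if "S \<in> sets M" "S \<subseteq> \<Omega>" for S
  proof -
    have "S \<in> sets lebesgue"
      using that \<Omega>_sets by (auto simp: M_def sets_restrict_space)
    then show ?thesis
      unfolding M_def using restrict_restrict_space[of \<Omega> lebesgue S] \<Omega>_sets that(2) by (simp add: Int_absorb1)
  qed
  have S_sub: "S\<^sub>1 \<subseteq> \<Omega>" "S\<^sub>2 \<subseteq> \<Omega>" by (auto simp: S\<^sub>1_def S\<^sub>2_def)
  have p1: "p 1 = 0" by (rule hd(4))
  have I1: "(LINT x|lebesgue_on S\<^sub>1. Q x) = 2 * (LINT x|lebesgue_on S\<^sub>1. \<zeta> x * \<bar>p (det (D x))\<bar> * det (D x))"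
  proof -
    have m: "f \<in> borel_measurable (lebesgue_on S\<^sub>1)" if "f \<in> borel_measurable M" for f :: "real^2 \<Rightarrow> real"
      unfolding restr[OF S_M(1) S_sub(1)] using that by (rule measurable_restrict_space1)
    have "(LINT x|lebesgue_on S\<^sub>1. Q x) = (LINT x|lebesgue_on S\<^sub>1. 2 * (\<zeta> x * \<bar>p (det (D x))\<bar> * det (D x)))"
    proof (rule integral_cong_AE)
      show "Q \<in> borel_measurable (lebesgue_on S\<^sub>1)"
        using Q_int by (intro m borel_measurable_integrable)
      show "(\<lambda>x. 2 * (\<zeta> x * \<bar>p (det (D x))\<bar> * det (D x))) \<in> borel_measurable (lebesgue_on S\<^sub>1)"
        by (rule m) measurable
      \<comment> \<open>Only a.e.: deducing \<open>p \<le> 0\<close> from monotonicity and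
        \<open>p 1 = 0\<close> needs a positive determinant. On \<open>S\<^sub>2\<close> the
        determinant is at least 1, so the identity in \<open>I2\<close> holds at every
        point.\<close>
      have "AE x in M. x \<in> S\<^sub>1 \<longrightarrow> Q x = 2 * (\<zeta> x * \<bar>p (det (D x))\<bar> * det (D x))"
        using u1(3)
      proof eventually_elim
        case (elim x)
        show ?case
        proof
          assume "x \<in> S\<^sub>1"
          then have "p (det (D x)) \<le> 0"
            using hd(2)[of "det (D x)" 1] elim p1 by (simp add: S\<^sub>1_def)
          then show "Q x = 2 * (\<zeta> x * \<bar>p (det (D x))\<bar> * det (D x))"
            by (simp add: Q_def)
        qed
      qed
      then show "AE x in lebesgue_on S\<^sub>1. Q x = 2 * (\<zeta> x * \<bar>p (det (D x))\<bar> * det (D x))"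
        unfolding restr[OF S_M(1) S_sub(1)] using S_M(1) by (subst AE_restrict_space_iff) auto
    qed
    then show ?thesis by simp
  qed
  have I2: "(LINT x|lebesgue_on S\<^sub>2. Q x) =
      2 * (LINT x|lebesgue_on S\<^sub>2. f (norm (x - x\<^sub>0)) * twist \<Omega> x x\<^sub>0 u * p (det (D x)) * \<bar>deriv f (norm (x - x\<^sub>0))\<bar>)"
  proof -
    have "(LINT x|lebesgue_on S\<^sub>2. Q x) =
        (LINT x|lebesgue_on S\<^sub>2. 2 * (f (norm (x - x\<^sub>0)) * twist \<Omega> x x\<^sub>0 u * p (det (D x)) * \<bar>deriv f (norm (x - x\<^sub>0))\<bar>))"
    proof (rule Bochner_Integration.integral_cong)
      fix x assume "x \<in> space (lebesgue_on S\<^sub>2)"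
      then have "1 \<le> det (D x)" by (simp add: S\<^sub>2_def)
      then have "p (det (D x)) \<ge> 0"
        using hd(2)[of 1 "det (D x)"] p1 by simp
      then show "Q x = 2 * (f (norm (x - x\<^sub>0)) * twist \<Omega> x x\<^sub>0 u * p (det (D x)) * \<bar>deriv f (norm (x - x\<^sub>0))\<bar>)"
        unfolding Q_def twist_eq by simp
    qed simp
    then show ?thesis by simp
  qed
  have split: "(LINT x|M. Q x) = (LINT x|lebesgue_on S\<^sub>1. Q x) + (LINT x|lebesgue_on S\<^sub>2. Q x)"
  proof -
    have "(LINT x|M. Q x) = (LINT x|M. indicator S\<^sub>1 x *\<^sub>R Q x + indicator S\<^sub>2 x *\<^sub>R Q x)"
      by (rule Bochner_Integration.integral_cong) (auto simp: space_M S\<^sub>1_def S\<^sub>2_def indicator_def)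
    also have "\<dots> = (LINT x|M. indicator S\<^sub>1 x *\<^sub>R Q x) + (LINT x|M. indicator S\<^sub>2 x *\<^sub>R Q x)"
      by (intro Bochner_Integration.integral_add integrable_mult_indicator S_M Q_int)
    also have "\<dots> = (LINT x|lebesgue_on S\<^sub>1. Q x) + (LINT x|lebesgue_on S\<^sub>2. Q x)"
      unfolding restr[OF S_M(1) S_sub(1)] restr[OF S_M(2) S_sub(2)] using S_M
      by (subst (1 2) integral_restrict_space) auto
    finally show ?thesis .
  qed
  \<comment> \<open>With this expansion both sides of \<open>Q_le\<close> carry the common factor 2,
    which cancels.\<close>
  have lhs: "D x \<bullet> (\<zeta> x *\<^sub>R D x + P x) = \<zeta> x * (norm (D x))\<^sup>2 + D x \<bullet> P x" for x
    by (simp add: inner_add_right power2_norm_eq_inner)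
  show ?thesis
    using Q_le unfolding split I1 I2 lhs
    unfolding Let_def D_def[symmetric] a_def[symmetric] S\<^sub>1_def[symmetric] S\<^sub>2_def[symmetric] M_def p_def P_def \<zeta>_def
    by simp
qed

end
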